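(* Let $\rho\succeq0$ be an operator on $\mathcal H_L$ with $\operatorname{tr}\rho=1$, and let $s\in(0,1]$ be its smallest positive eigenvalue. Let $\mathcal C:\mathsf L(\mathcal H_L)\to\mathsf L(\mathcal H_C)$, $\mathcal N:\mathsf L(\mathcal H_C)\to\mathsf L(\mathcal H_C)$ and $\mathcal D:\mathsf L(\mathcal H_C)\to\mathsf L(\mathcal H_L)$ be completely positive trace-non-increasing (CPTNI) maps, set $\mathcal A:=\mathcal D\circ\mathcal N$, and put $$\varepsilon:=1-F_{\mathrm e}(\rho,\mathcal A\circ\mathcal C).$$ Then there exists a partial isometry $W:\mathcal H_L\to\mathcal H_C$ such that, with $\mathcal C_1(\omega):=W\omega W^\dagger$ and $\varepsilon_1:=1-F_{\mathrm e}(\rho,\mathcal A\circ\mathcal C_1)$, one has $$\varepsilon_1-\varepsilon\le\begin{cases}(s^{-1}-1)\,\ell_s(\varepsilon)^2,&0\le\varepsilon\le s,\\(1-\varepsilon)\min\{\varepsilon,1-s\},&s<\varepsilon\le1,\end{cases}$$ where $\ell_s(x):=\dfrac{x}{1+\sqrt{1-x/s}}$ for $0\le x\le s$.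
   Context: $\mathcal H_L=\mathbb C^{d_L}$ and $\mathcal H_C=\mathbb C^{d_C}$ with $1<d_L\le d_C<\infty$. $\mathsf L(\mathcal H)$ is the space of linear operators on $\mathcal H$. A CPTNI map is a completely positive map with $\sum_jL_j^\dagger L_j\preceq I$ for its Kraus operators $L_j$. For a state $\rho$ on $\mathcal H_L$ and a completely positive map $\Phi:\mathsf L(\mathcal H_L)\to\mathsf L(\mathcal H_L)$ with Kraus operators $F_j$, the entanglement fidelity is $F_{\mathrm e}(\rho,\Phi):=\sum_j|\operatorname{tr}(\rho F_j)|^2$ (independent of the choice of Kraus operators). *)

theory Defs
  imports
    Complex_Main
    "Jordan_Normal_Form.Char_Poly"
    "Jordan_Normal_Form.Schur_Decomposition"
begin

text \<open>
  The Hilbert space of dimension \<open>n\<close> is \<open>carrier_vec n\<close> over the complex numbers, and an operator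
  from dimension \<open>n\<close> to dimension \<open>m\<close> is an element of \<open>carrier_mat m n\<close>.
\<close>

definition mat_trace :: "complex mat \<Rightarrow> complex" where
  "mat_trace A = (\<Sum>i<dim_row A. A $$ (i, i))"

definition mat_sum :: "nat \<Rightarrow> nat \<Rightarrow> complex mat list \<Rightarrow> complex mat" where
  "mat_sum m n As = foldr (+) As (0\<^sub>m m n)"

text \<open>The order used here is that of \<open>Complex_Order\<close>: \<open>0 \<le> z\<close> says that \<open>z\<close> is real and nonnegative.
  Over the complex numbers this makes \<open>A\<close> Hermitian.\<close>

definition psd :: "nat \<Rightarrow> complex mat \<Rightarrow> bool" where
  "psd n A \<longleftrightarrow> A \<in> carrier_mat n n \<and> (\<forall>v\<in>carrier_vec n. 0 \<le> (A *\<^sub>v v) \<bullet>c v)"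

definition loewner_le :: "nat \<Rightarrow> complex mat \<Rightarrow> complex mat \<Rightarrow> bool" where
  "loewner_le n A B \<longleftrightarrow> A \<in> carrier_mat n n \<and> B \<in> carrier_mat n n \<and> psd n (B - A)"

definition smallest_positive_eigenvalue :: "complex mat \<Rightarrow> real \<Rightarrow> bool" where
  "smallest_positive_eigenvalue A s \<longleftrightarrow>
     0 < s \<and> eigenvalue A (complex_of_real s) \<and>
     (\<forall>t. 0 < t \<longrightarrow> eigenvalue A (complex_of_real t) \<longrightarrow> s \<le> t)"

text \<open>
  A map from operators on dimension \<open>n\<close> to operators on dimension \<open>m\<close> is a function on matrices of
  which only the values on \<open>carrier_mat n n\<close> matter.
\<close>

definition linear_map :: "nat \<Rightarrow> nat \<Rightarrow> (complex mat \<Rightarrow> complex mat) \<Rightarrow> bool" where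
  "linear_map n m \<Phi> \<longleftrightarrow>
     (\<forall>X\<in>carrier_mat n n. \<Phi> X \<in> carrier_mat m m) \<and>
     (\<forall>X\<in>carrier_mat n n. \<forall>Y\<in>carrier_mat n n. \<Phi> (X + Y) = \<Phi> X + \<Phi> Y) \<and>
     (\<forall>c. \<forall>X\<in>carrier_mat n n. \<Phi> (c \<cdot>\<^sub>m X) = c \<cdot>\<^sub>m \<Phi> X)"

text \<open>
  The map \<open>id\<^sub>k \<otimes> \<Phi>\<close>: an operator on the tensor product of dimension \<open>k * n\<close> is a \<open>k\<close> by \<open>k\<close> array
  of blocks of size \<open>n\<close>, the index \<open>p\<close> standing for the pair \<open>(p div n, p mod n)\<close>, and \<open>\<Phi>\<close> is
  applied to every block.
\<close>

definition mat_block :: "nat \<Rightarrow> complex mat \<Rightarrow> nat \<Rightarrow> nat \<Rightarrow> complex mat" where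
  "mat_block n X i j = mat n n (\<lambda>(a, b). X $$ (i * n + a, j * n + b))"

definition amplification ::
  "nat \<Rightarrow> nat \<Rightarrow> nat \<Rightarrow> (complex mat \<Rightarrow> complex mat) \<Rightarrow> complex mat \<Rightarrow> complex mat" where
  "amplification k n m \<Phi> X =
     mat (k * m) (k * m) (\<lambda>(p, q). \<Phi> (mat_block n X (p div m) (q div m)) $$ (p mod m, q mod m))"

definition completely_positive :: "nat \<Rightarrow> nat \<Rightarrow> (complex mat \<Rightarrow> complex mat) \<Rightarrow> bool" where
  "completely_positive n m \<Phi> \<longleftrightarrow>
     linear_map n m \<Phi> \<and>
     (\<forall>k X. psd (k * n) X \<longrightarrow> psd (k * m) (amplification k n m \<Phi> X))"

definition kraus_operators ::
  "nat \<Rightarrow> nat \<Rightarrow> (complex mat \<Rightarrow> complex mat) \<Rightarrow> complex mat list \<Rightarrow> bool" where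
  "kraus_operators n m \<Phi> Ks \<longleftrightarrow>
     set Ks \<subseteq> carrier_mat m n \<and>
     (\<forall>X\<in>carrier_mat n n. \<Phi> X = mat_sum m m (map (\<lambda>K. K * X * mat_adjoint K) Ks))"

definition cptni :: "nat \<Rightarrow> nat \<Rightarrow> (complex mat \<Rightarrow> complex mat) \<Rightarrow> bool" where
  "cptni n m \<Phi> \<longleftrightarrow>
     completely_positive n m \<Phi> \<and>
     (\<exists>Ks. kraus_operators n m \<Phi> Ks \<and>
           loewner_le n (mat_sum n n (map (\<lambda>K. mat_adjoint K * K) Ks)) (1\<^sub>m n))"

text \<open>The value does not depend on the Kraus operators; see \<open>entanglement_fidelity_kraus\<close> below.\<close>

definition entanglement_fidelity ::
  "nat \<Rightarrow> complex mat \<Rightarrow> (complex mat \<Rightarrow> complex mat) \<Rightarrow> real" where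
  "entanglement_fidelity n \<rho> \<Phi> =
     (THE f. \<exists>Fs. kraus_operators n n \<Phi> Fs \<and> f = (\<Sum>F\<leftarrow>Fs. (cmod (mat_trace (\<rho> * F)))\<^sup>2))"

text \<open>A partial isometry preserves norms on the orthogonal complement of its kernel.\<close>

definition partial_isometry :: "nat \<Rightarrow> nat \<Rightarrow> complex mat \<Rightarrow> bool" where
  "partial_isometry n m W \<longleftrightarrow>
     W \<in> carrier_mat m n \<and>
     (\<forall>v\<in>carrier_vec n.
        (\<forall>u\<in>carrier_vec n. W *\<^sub>v u = 0\<^sub>v m \<longrightarrow> v \<bullet>c u = 0) \<longrightarrow>
        (W *\<^sub>v v) \<bullet>c (W *\<^sub>v v) = v \<bullet>c v)"

definition ell :: "real \<Rightarrow> real \<Rightarrow> real" where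
  "ell s x = x / (1 + sqrt (1 - x / s))"

lemma mat_adjoint_dims [simp]:
  "dim_row (mat_adjoint A) = dim_col A" "dim_col (mat_adjoint A) = dim_row A"
  by (simp_all add: mat_adjoint_def)

lemma mat_adjoint_index:
  "i < dim_col A \<Longrightarrow> j < dim_row A \<Longrightarrow> mat_adjoint A $$ (i, j) = cnj (A $$ (j, i))"
  by (simp add: mat_adjoint_def mat_of_rows_def cols_def)

lemma mat_sum_dims:
  assumes "set As \<subseteq> carrier_mat m n"
  shows "mat_sum m n As \<in> carrier_mat m n"
  using assms by (induction As) (auto simp: mat_sum_def)

lemma mat_sum_index:
  assumes "set As \<subseteq> carrier_mat m n" "i < m" "j < n"
  shows "mat_sum m n As $$ (i, j) = (\<Sum>A\<leftarrow>As. A $$ (i, j))"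
  using assms
proof (induction As)
  case Nil
  then show ?case by (simp add: mat_sum_def)
next
  case (Cons A As)
  have c: "mat_sum m n As \<in> carrier_mat m n"
    using Cons.prems by (intro mat_sum_dims) auto
  have "mat_sum m n (A # As) = A + mat_sum m n As" by (simp add: mat_sum_def)
  then show ?case using Cons c by auto
qed

lemma kraus_unit_index:
  assumes K: "K \<in> carrier_mat m n" and "a < n" "c < n" "b < m" "d < m"
  shows "(K * mat n n (\<lambda>(x, y). if x = a \<and> y = c then 1 else 0) * mat_adjoint K) $$ (b, d)
         = K $$ (b, a) * cnj (K $$ (d, c))"
proof -
  let ?E = "mat n n (\<lambda>(x, y). if x = a \<and> y = c then 1 else (0::complex))"
  have dims: "dim_row K = m" "dim_col K = n" using K by auto
  have KE: "(K * ?E) $$ (b, y) = (if y = c then K $$ (b, a) else 0)" if "y < n" for y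
  proof -
    have "(K * ?E) $$ (b, y) = (\<Sum>x = 0..<n. K $$ (b, x) * (if x = a \<and> y = c then 1 else 0))"
      using that assms dims by (simp add: scalar_prod_def)
    also have "\<dots> = (\<Sum>x = 0..<n. if x = a then (if y = c then K $$ (b, a) else 0) else 0)"
      by (intro sum.cong) auto
    finally show ?thesis using assms by simp
  qed
  have "(K * ?E * mat_adjoint K) $$ (b, d)
        = (\<Sum>y = 0..<n. (K * ?E) $$ (b, y) * mat_adjoint K $$ (y, d))"
    using assms dims by (simp add: scalar_prod_def del: index_mult_mat(1))
       (simp add: index_mult_mat(1)[of b "K * ?E" d "mat_adjoint K"] scalar_prod_def del: index_mult_mat(1))
  also have "\<dots> = (\<Sum>y = 0..<n. if y = c then K $$ (b, a) * cnj (K $$ (d, c)) else 0)"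
    using assms dims by (intro sum.cong) (auto simp: KE mat_adjoint_index simp del: index_mult_mat(1))
  finally show ?thesis using assms by simp
qed

lemma fidelity_kraus_aux:
  assumes \<rho>: "\<rho> \<in> carrier_mat n n" and F: "kraus_operators n n \<Phi> Fs"
  shows "complex_of_real (\<Sum>F\<leftarrow>Fs. (cmod (mat_trace (\<rho> * F)))\<^sup>2) =
    (\<Sum>i<n. \<Sum>j<n. \<Sum>a<n. \<Sum>c<n. \<rho> $$ (i, a) * cnj (\<rho> $$ (j, c)) *
       \<Phi> (mat n n (\<lambda>(x, y). if x = i \<and> y = j then 1 else 0)) $$ (a, c))"
proof -
  have car: "set Fs \<subseteq> carrier_mat n n" using F by (simp add: kraus_operators_def)
  have \<Phi>: "\<Phi> (mat n n (\<lambda>(x, y). if x = i \<and> y = j then 1 else 0)) $$ (a, c)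
      = (\<Sum>F\<leftarrow>Fs. F $$ (a, i) * cnj (F $$ (c, j)))"
    if "i < n" "j < n" "a < n" "c < n" for i j a c
  proof -
    let ?E = "mat n n (\<lambda>(x, y). if x = i \<and> y = j then 1 else (0::complex))"
    have "set (map (\<lambda>K. K * ?E * mat_adjoint K) Fs) \<subseteq> carrier_mat n n"
      using car by (auto intro!: carrier_matI)
    then have "\<Phi> ?E $$ (a, c) = (\<Sum>F\<leftarrow>Fs. (F * ?E * mat_adjoint F) $$ (a, c))"
      using F that by (simp add: kraus_operators_def mat_sum_index o_def del: index_mult_mat)
    also have "\<dots> = (\<Sum>F\<leftarrow>Fs. F $$ (a, i) * cnj (F $$ (c, j)))"
      using car that
      by (intro arg_cong[where f = sum_list] map_cong refl kraus_unit_index[where m = n and n = n]) auto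
    finally show ?thesis .
  qed
  have single: "complex_of_real ((cmod (mat_trace (\<rho> * F)))\<^sup>2) =
      (\<Sum>i<n. \<Sum>j<n. \<Sum>a<n. \<Sum>c<n.
         \<rho> $$ (i, a) * cnj (\<rho> $$ (j, c)) * (F $$ (a, i) * cnj (F $$ (c, j))))"
    if "F \<in> carrier_mat n n" for F
  proof -
    have "mat_trace (\<rho> * F) = (\<Sum>i<n. \<Sum>a<n. \<rho> $$ (i, a) * F $$ (a, i))"
      using \<rho> that by (auto simp: mat_trace_def scalar_prod_def lessThan_atLeast0 intro!: sum.cong)
    then show ?thesis
      by (simp only: complex_norm_square cnj_sum complex_cnj_mult sum_product)
         (simp add: mult_ac)
  qed
  have "complex_of_real (\<Sum>F\<leftarrow>Fs. (cmod (mat_trace (\<rho> * F)))\<^sup>2)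
      = (\<Sum>i<n. \<Sum>j<n. \<Sum>a<n. \<Sum>c<n. \<rho> $$ (i, a) * cnj (\<rho> $$ (j, c)) *
           (\<Sum>F\<leftarrow>Fs. F $$ (a, i) * cnj (F $$ (c, j))))"
    using car
  proof (induction Fs)
    case Nil
    then show ?case by simp
  next
    case (Cons F Fs)
    then have "F \<in> carrier_mat n n" by simp
    from single[OF this] Cons show ?case
      by (simp add: distrib_left sum.distrib)
  qed
  then show ?thesis using \<Phi> by simp
qed

lemma entanglement_fidelity_kraus:
  assumes "\<rho> \<in> carrier_mat n n" and "kraus_operators n n \<Phi> Fs"
  shows "entanglement_fidelity n \<rho> \<Phi> = (\<Sum>F\<leftarrow>Fs. (cmod (mat_trace (\<rho> * F)))\<^sup>2)"
  unfolding entanglement_fidelity_def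
proof (rule the_equality)
  show "\<exists>Gs. kraus_operators n n \<Phi> Gs \<and>
      (\<Sum>F\<leftarrow>Fs. (cmod (mat_trace (\<rho> * F)))\<^sup>2) = (\<Sum>F\<leftarrow>Gs. (cmod (mat_trace (\<rho> * F)))\<^sup>2)"
    using assms(2) by blast
next
  fix f
  assume "\<exists>Gs. kraus_operators n n \<Phi> Gs \<and> f = (\<Sum>F\<leftarrow>Gs. (cmod (mat_trace (\<rho> * F)))\<^sup>2)"
  then obtain Gs where "kraus_operators n n \<Phi> Gs"
    and f: "f = (\<Sum>F\<leftarrow>Gs. (cmod (mat_trace (\<rho> * F)))\<^sup>2)" by blast
  then have "complex_of_real f = complex_of_real (\<Sum>F\<leftarrow>Fs. (cmod (mat_trace (\<rho> * F)))\<^sup>2)"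
    using fidelity_kraus_aux[OF assms(1)] assms(2) by simp
  then show "f = (\<Sum>F\<leftarrow>Fs. (cmod (mat_trace (\<rho> * F)))\<^sup>2)"
    by (simp only: of_real_eq_iff)
qed

end

theory Submission
  imports Defs
begin

text \<open>
  Let \<open>A\<^sub>k\<close> and \<open>L\<^sub>j\<close> be Kraus operators of \<open>\<A>\<close> and \<open>\<C>\<close>, so that the fidelity \<open>F = 1 - \<epsilon>\<close> is the sum over \<open>j\<close>
  of \<open>f\<^sub>j = \<Sum>\<^sub>k \<bar>tr (\<rho> A\<^sub>k L\<^sub>j)\<bar>\<^sup>2\<close>. For a suitable \<open>j\<close> the unit combination
  \<open>B = (1 / sqrt f\<^sub>j) \<Sum>\<^sub>k cnj (tr (\<rho> A\<^sub>k L\<^sub>j)) A\<^sub>k\<close> is a contraction with \<open>b := tr (\<rho> B B\<^sup>*) \<ge> F\<close>. Take \<open>W\<close> from the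
  polar decomposition \<open>\<rho> B W = R \<ge> 0\<close>; the new fidelity is at least \<open>r\<^sup>2\<close> for \<open>r = tr R\<close>.
  From \<open>\<rho>\<^sup>2 \<ge> s \<rho>\<close> we get \<open>r\<^sup>2 \<ge> tr R\<^sup>2 = tr (\<rho>\<^sup>2 B B\<^sup>*) \<ge> s b\<close>, and clearly \<open>r \<ge> b\<close>; this settles \<open>\<epsilon> > s\<close>.
  Since \<open>B\<close> is a contraction, \<open>R\<^sup>2 = \<rho> B B\<^sup>* \<rho> \<le> \<rho>\<^sup>2\<close> and hence \<open>\<Delta> = \<rho> - R \<ge> 0\<close>. With \<open>Y = 1 - B W\<close> one has
  \<open>\<rho> Y = \<Delta>\<close> and \<open>tr (\<rho> Y Y\<^sup>*) = 1 - 2 r + b\<close>, while \<open>s tr (\<rho> Y Y\<^sup>*) \<le> tr \<Delta>\<^sup>2 \<le> (tr \<Delta>)\<^sup>2 = (1 - r)\<^sup>2\<close>. For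
  \<open>\<epsilon> \<le> s\<close> this quadratic inequality gives \<open>r \<ge> 1 - \<ell>\<^sub>s(\<epsilon>)\<close>.
\<close>

section \<open>Adjoints, traces and positivity\<close>

lemma adjoint_carrier [simp, intro]:
  "A \<in> carrier_mat m n \<Longrightarrow> mat_adjoint A \<in> carrier_mat n m"
  by (auto intro: carrier_matI)

lemma adjoint_adjoint [simp]: "mat_adjoint (mat_adjoint A) = (A :: complex mat)"
  by (rule eq_matI) (auto simp: mat_adjoint_index)

lemma adjoint_mult:
  fixes A B :: "complex mat"
  assumes "A \<in> carrier_mat m k" "B \<in> carrier_mat k n"
  shows "mat_adjoint (A * B) = mat_adjoint B * mat_adjoint A"
  using assms by (intro eq_matI) (auto simp: mat_adjoint_index scalar_prod_def mult.commute intro!: sum.cong)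

lemma adjoint_minus:
  fixes A B :: "complex mat"
  assumes "A \<in> carrier_mat m n" "B \<in> carrier_mat m n"
  shows "mat_adjoint (A - B) = mat_adjoint A - mat_adjoint B"
  using assms by (intro eq_matI) (auto simp: mat_adjoint_index)

lemma adjoint_smult: "mat_adjoint (c \<cdot>\<^sub>m A) = cnj c \<cdot>\<^sub>m mat_adjoint A"
  by (intro eq_matI) (auto simp: mat_adjoint_index)

lemma adjoint_one [simp]: "mat_adjoint (1\<^sub>m n) = (1\<^sub>m n :: complex mat)"
  by (rule eq_matI) (auto simp: mat_adjoint_index)

lemma adjoint_diag: "mat_adjoint (mat_diag n f) = mat_diag n (\<lambda>i. cnj (f i))"
  by (rule eq_matI) (auto simp: mat_adjoint_index mat_diag_def)

lemma trace_comm: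
  assumes "A \<in> carrier_mat m n" "B \<in> carrier_mat n m"
  shows "mat_trace (A * B) = mat_trace (B * A)"
proof -
  have "mat_trace (A * B) = (\<Sum>i<m. \<Sum>j<n. A $$ (i, j) * B $$ (j, i))"
    using assms by (auto simp: mat_trace_def scalar_prod_def lessThan_atLeast0 intro!: sum.cong)
  also have "\<dots> = (\<Sum>j<n. \<Sum>i<m. B $$ (j, i) * A $$ (i, j))"
    by (subst sum.swap) (simp add: mult.commute)
  also have "\<dots> = mat_trace (B * A)"
    using assms by (auto simp: mat_trace_def scalar_prod_def lessThan_atLeast0 intro!: sum.cong)
  finally show ?thesis .
qed

lemma trace_add:
  assumes "A \<in> carrier_mat n n" "B \<in> carrier_mat n n"
  shows "mat_trace (A + B) = mat_trace A + mat_trace B"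
  using assms by (auto simp: mat_trace_def sum.distrib)

lemma trace_minus:
  assumes "A \<in> carrier_mat n n" "B \<in> carrier_mat n n"
  shows "mat_trace (A - B) = mat_trace A - mat_trace B"
  using assms by (auto simp: mat_trace_def sum_subtractf)

lemma trace_smult:
  assumes "A \<in> carrier_mat n n"
  shows "mat_trace (c \<cdot>\<^sub>m A) = c * mat_trace A"
  using assms by (auto simp: mat_trace_def sum_distrib_left)

lemma trace_adjoint:
  assumes "A \<in> carrier_mat n n"
  shows "mat_trace (mat_adjoint A) = cnj (mat_trace A)"
  using assms by (auto simp: mat_trace_def mat_adjoint_index)

lemma trace_diag: "mat_trace (mat_diag n f) = (\<Sum>i<n. f i)"
  by (simp add: mat_trace_def mat_diag_def)

lemma trace_one [simp]: "mat_trace (1\<^sub>m n) = of_nat n"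
  by (simp add: mat_trace_def)

section \<open>Inner products of vectors and their behaviour under adjoints\<close>

lemma cscalar_sum:
  fixes v w :: "complex vec"
  assumes "w \<in> carrier_vec n"
  shows "v \<bullet>c w = (\<Sum>i<n. v $ i * cnj (w $ i))"
  using assms by (simp add: scalar_prod_def lessThan_atLeast0)

lemma cscalar_self:
  fixes v :: "complex vec"
  assumes "v \<in> carrier_vec n"
  shows "v \<bullet>c v = complex_of_real (\<Sum>i<n. (cmod (v $ i))\<^sup>2)"
  using assms by (simp only: cscalar_sum of_real_sum complex_norm_square)

lemma cscalar_self_zero:
  fixes v :: "complex vec"
  assumes "v \<in> carrier_vec n" "v \<bullet>c v = 0"
  shows "v = 0\<^sub>v n"
  using assms conjugate_square_eq_0_vec by blast

lemma cscalar_commute: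
  fixes v w :: "complex vec"
  assumes "v \<in> carrier_vec n" "w \<in> carrier_vec n"
  shows "w \<bullet>c v = cnj (v \<bullet>c w)"
  using assms by (simp add: cscalar_sum mult.commute)

lemma cscalar_adjoint:
  fixes A :: "complex mat"
  assumes A: "A \<in> carrier_mat m n" and v: "v \<in> carrier_vec n" and w: "w \<in> carrier_vec m"
  shows "(A *\<^sub>v v) \<bullet>c w = v \<bullet>c (mat_adjoint A *\<^sub>v w)"
proof -
  have "(A *\<^sub>v v) \<bullet>c w = (\<Sum>i<m. \<Sum>j<n. A $$ (i, j) * v $ j * cnj (w $ i))"
    using A v w by (auto simp: cscalar_sum scalar_prod_def lessThan_atLeast0 sum_distrib_right intro!: sum.cong)
  also have "\<dots> = (\<Sum>j<n. \<Sum>i<m. A $$ (i, j) * v $ j * cnj (w $ i))"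
    by (rule sum.swap)
  also have "\<dots> = v \<bullet>c (mat_adjoint A *\<^sub>v w)"
    using A w by (subst cscalar_sum[OF mult_mat_vec_carrier[OF adjoint_carrier[OF A] w]])
      (auto simp: scalar_prod_def lessThan_atLeast0 sum_distrib_left mat_adjoint_index mult_ac intro!: sum.cong)
  finally show ?thesis .
qed

lemma cscalar_gram:
  fixes A :: "complex mat"
  assumes A: "A \<in> carrier_mat m n" and v: "v \<in> carrier_vec n" and w: "w \<in> carrier_vec n"
  shows "(A *\<^sub>v v) \<bullet>c (A *\<^sub>v w) = ((mat_adjoint A * A) *\<^sub>v v) \<bullet>c w"
proof -
  have "((mat_adjoint A * A) *\<^sub>v v) \<bullet>c w = (mat_adjoint A *\<^sub>v (A *\<^sub>v v)) \<bullet>c w"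
    using A v by (subst assoc_mult_mat_vec[of _ n m _ n]) auto
  also have "\<dots> = (A *\<^sub>v v) \<bullet>c (A *\<^sub>v w)"
    using A v w cscalar_adjoint[of "mat_adjoint A" n m "A *\<^sub>v v" w] by auto
  finally show ?thesis ..
qed

lemma cscalar_unit:
  fixes v :: "complex vec"
  assumes "v \<in> carrier_vec n" "j < n"
  shows "v \<bullet>c unit_vec n j = v $ j"
proof -
  have "v \<bullet>c unit_vec n j = (\<Sum>i<n. if i = j then v $ i else 0)"
    unfolding cscalar_sum[OF unit_vec_carrier] using assms by (intro sum.cong) auto
  then show ?thesis using assms by simp
qed

lemma cscalar_minus_left:
  fixes u v w :: "complex vec"
  assumes "u \<in> carrier_vec n" "v \<in> carrier_vec n" "w \<in> carrier_vec n"
  shows "(u - v) \<bullet>c w = u \<bullet>c w - v \<bullet>c w"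
  using assms by (simp add: cscalar_sum left_diff_distrib sum_subtractf)

lemma cscalar_smult_left:
  fixes v w :: "complex vec"
  assumes "v \<in> carrier_vec n" "w \<in> carrier_vec n"
  shows "(a \<cdot>\<^sub>v v) \<bullet>c w = a * (v \<bullet>c w)"
  using assms by (simp add: cscalar_sum sum_distrib_left mult.assoc)

lemma cscalar_smult_right:
  fixes v w :: "complex vec"
  assumes "v \<in> carrier_vec n" "w \<in> carrier_vec n"
  shows "v \<bullet>c (a \<cdot>\<^sub>v w) = cnj a * (v \<bullet>c w)"
  using assms by (simp add: cscalar_sum[of _ n] sum_distrib_left mult_ac)

lemma cscalar_add_left:
  fixes u v w :: "complex vec"
  assumes "u \<in> carrier_vec n" "v \<in> carrier_vec n" "w \<in> carrier_vec n"
  shows "(u + v) \<bullet>c w = u \<bullet>c w + v \<bullet>c w"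
  using assms by (simp add: cscalar_sum distrib_right sum.distrib)

lemma cscalar_add_right:
  fixes u v w :: "complex vec"
  assumes "u \<in> carrier_vec n" "v \<in> carrier_vec n" "w \<in> carrier_vec n"
  shows "u \<bullet>c (v + w) = u \<bullet>c v + u \<bullet>c w"
  using assms by (simp add: cscalar_sum[of _ n] distrib_left sum.distrib)

lemma cscalar_minus_right:
  fixes u v w :: "complex vec"
  assumes "u \<in> carrier_vec n" "v \<in> carrier_vec n" "w \<in> carrier_vec n"
  shows "u \<bullet>c (v - w) = u \<bullet>c v - u \<bullet>c w"
  using assms by (simp add: cscalar_sum[of _ n] right_diff_distrib sum_subtractf)

section \<open>Positivity of the quadratic form: traces, congruences, hermiticity\<close>

lemma psd_carrier: "psd n A \<Longrightarrow> A \<in> carrier_mat n n"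
  by (simp add: psd_def)

lemma psd_trace:
  assumes "psd n A"
  shows "0 \<le> mat_trace A"
proof -
  have A: "A \<in> carrier_mat n n" using assms by (rule psd_carrier)
  have "0 \<le> A $$ (i, i)" if "i < n" for i
  proof -
    have "(A *\<^sub>v unit_vec n i) \<bullet>c unit_vec n i = A $$ (i, i)"
      using A that by (subst cscalar_unit) auto
    moreover have "0 \<le> (A *\<^sub>v unit_vec n i) \<bullet>c unit_vec n i"
      using assms by (simp add: psd_def)
    ultimately show ?thesis using that by simp
  qed
  then show ?thesis using A by (auto simp: mat_trace_def intro!: sum_nonneg)
qed

text \<open>The form of X* M X at v is the form of M at X v.\<close>

lemma psd_congruence:
  assumes M: "psd m M" and X: "X \<in> carrier_mat m n"
  shows "psd n (mat_adjoint X * M * X)"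
  unfolding psd_def
proof (intro conjI ballI)
  have Mc: "M \<in> carrier_mat m m" using M by (rule psd_carrier)
  show "mat_adjoint X * M * X \<in> carrier_mat n n" using X Mc by auto
  fix v :: "complex vec" assume v: "v \<in> carrier_vec n"
  have "(mat_adjoint X * M * X) *\<^sub>v v = mat_adjoint X *\<^sub>v (M *\<^sub>v (X *\<^sub>v v))"
    using X Mc v by (subst assoc_mult_mat_vec[of _ n m _ n]; (subst assoc_mult_mat_vec[of _ n m _ m])?) auto
  moreover have "(mat_adjoint X *\<^sub>v (M *\<^sub>v (X *\<^sub>v v))) \<bullet>c v = (M *\<^sub>v (X *\<^sub>v v)) \<bullet>c (X *\<^sub>v v)"
    using X Mc v cscalar_adjoint[of "mat_adjoint X" n m "M *\<^sub>v (X *\<^sub>v v)" v] by auto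
  moreover have "0 \<le> (M *\<^sub>v (X *\<^sub>v v)) \<bullet>c (X *\<^sub>v v)"
    using M X v by (auto simp: psd_def)
  ultimately show "0 \<le> ((mat_adjoint X * M * X) *\<^sub>v v) \<bullet>c v" by simp
qed

lemma psd_gram:
  assumes "X \<in> carrier_mat m n"
  shows "psd n (mat_adjoint X * X)"
proof -
  have "psd m (1\<^sub>m m)" by (auto simp: psd_def)
  from psd_congruence[OF this assms] show ?thesis using assms by auto
qed

text \<open>Polarisation: the form is real at
  \<open>unit_vec n i + c \<cdot>\<^sub>v unit_vec n j\<close> for every c. The values c = 1 and c =
  -1 make the imaginary parts of the two off-diagonal entries opposite, and c = \<i> makes their
  real parts equal.\<close>

lemma psd_hermitian:
  assumes "psd n A"
  shows "mat_adjoint A = A"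
proof (rule eq_matI)
  have A: "A \<in> carrier_mat n n" using assms by (rule psd_carrier)
  fix i j assume "i < dim_row A" "j < dim_col A"
  then have ij: "i < n" "j < n" using A by auto
  define E where "E i j = (A *\<^sub>v unit_vec n i) \<bullet>c unit_vec n j" for i j
  have E: "E i j = A $$ (j, i)" if "i < n" "j < n" for i j
    unfolding E_def using A that by (subst cscalar_unit) auto
  have im: "Im (E i i + cnj c * E i j + c * E j i + c * cnj c * E j j) = 0" for c
  proof -
    let ?v = "unit_vec n i + c \<cdot>\<^sub>v unit_vec n j"
    have v: "?v \<in> carrier_vec n" by auto
    have "0 \<le> (A *\<^sub>v ?v) \<bullet>c ?v" using assms v by (simp only: psd_def)
    also have "A *\<^sub>v ?v = A *\<^sub>v unit_vec n i + c \<cdot>\<^sub>v (A *\<^sub>v unit_vec n j)"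
      using A by (simp add: mult_add_distrib_mat_vec mult_mat_vec)
    also have "\<dots> \<bullet>c ?v = E i i + cnj c * E i j + c * E j i + c * cnj c * E j j"
      unfolding E_def using A
      by (simp add: cscalar_add_left[of _ n] cscalar_add_right[of _ n] cscalar_smult_left[of _ n] cscalar_smult_right[of _ n] algebra_simps)
    finally show ?thesis by (simp add: less_eq_complex_def)
  qed
  have "cnj (A $$ (j, i)) = A $$ (i, j)"
    using im[of 0] im[of 1] im[of \<i>] im[of "-1"] E[of i j] E[of j i] ij
    by (auto simp: complex_eq_iff)
  then show "mat_adjoint A $$ (i, j) = A $$ (i, j)"
    using A ij by (simp add: mat_adjoint_index)
qed (use psd_carrier[OF assms] in auto)

section \<open>The spectral theorem\<close>

text \<open>If every eigenvalue vanished, a triangularisation would give \<open>tr (B\<^sup>2) = 0\<close>, which is the sum of all \<open>\<bar>B\<^sub>i\<^sub>j\<bar>\<^sup>2\<close>.\<close>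

lemma hermitian_nonzero_eigenvector:
  fixes B :: "complex mat"
  assumes B: "B \<in> carrier_mat n n" and herm: "mat_adjoint B = B" and nz: "B \<noteq> 0\<^sub>m n n"
  obtains v c where "v \<in> carrier_vec n" "v \<noteq> 0\<^sub>v n" "c \<noteq> 0" "B *\<^sub>v v = c \<cdot>\<^sub>v v"
proof -
  obtain es where es: "char_poly B = (\<Prod>a\<leftarrow>es. [:- a, 1:])" "length es = n"
    using char_poly_factorized[OF B] by blast
  obtain U P Q where "schur_decomposition B es = (U, P, Q)" by (cases "schur_decomposition B es")
  from schur_decomposition[OF B es(1) this]
  have sim: "similar_mat_wit B U P Q" and ut: "upper_triangular U" and dU: "diag_mat U = es" by auto
  have U: "U \<in> carrier_mat n n" and P: "P \<in> carrier_mat n n" and Q: "Q \<in> carrier_mat n n"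
    and QP: "Q * P = 1\<^sub>m n" and BU: "B = P * U * Q"
    using similar_mat_witD2[OF B sim] by auto
  have "\<exists>c\<in>set es. c \<noteq> 0"
  proof (rule ccontr)
    assume no: "\<not> (\<exists>c\<in>set es. c \<noteq> 0)"
    have mem: "U $$ (i, i) \<in> set es" if "i < n" for i
      unfolding dU[symmetric] diag_mat_def using carrier_matD(1)[OF U] that by simp
    have z: "U $$ (i, i) = 0" if "i < n" for i
      using no mem[OF that] by metis
    \<comment> \<open>Cancelling Q P = 1 inside B B and cycling the trace leaves tr (U U).\<close>
    have QPUQ: "Q * (P * (U * Q)) = U * Q"
      using assoc_mult_mat[OF Q P mult_carrier_mat[OF U Q]] QP left_mult_one_mat[OF mult_carrier_mat[OF U Q]]
      by simp
    have "B * B = P * (U * (Q * (P * (U * Q))))"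
      unfolding BU using P U Q by (simp add: assoc_mult_mat[of _ n n _ n _ n])
    then have "B * B = P * (U * U * Q)"
      unfolding QPUQ using P U Q by (simp add: assoc_mult_mat[of _ n n _ n _ n])
    then have "mat_trace (B * B) = mat_trace (U * U * Q * P)"
      using P U Q by (simp add: trace_comm[of P n n])
    also have "U * U * Q * P = U * U"
      using P U Q QP by (simp add: assoc_mult_mat[of _ n n _ n _ n])
    also have "mat_trace (U * U) = (\<Sum>i<n. \<Sum>j<n. U $$ (i, j) * U $$ (j, i))"
      using U by (auto simp: mat_trace_def scalar_prod_def lessThan_atLeast0 intro!: sum.cong)
    \<comment> \<open>For i different from j one of the two factors lies below the diagonal of U;
      for i = j both are diagonal entries, which vanish by assumption.\<close>
    also have "\<dots> = 0"
    proof (intro sum.neutral ballI)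
      fix i j assume "i \<in> {..<n}" "j \<in> {..<n}"
      then show "U $$ (i, j) * U $$ (j, i) = 0"
        using z[of i] upper_triangularD[OF ut, of i j] upper_triangularD[OF ut, of j i] U
        by (cases i j rule: linorder_cases) auto
    qed
    finally have "mat_trace (B * mat_adjoint B) = 0" using herm by simp
    moreover have "mat_trace (B * mat_adjoint B) = complex_of_real (\<Sum>i<n. \<Sum>j<n. (cmod (B $$ (i, j)))\<^sup>2)"
      using B unfolding of_real_sum complex_norm_square
      by (auto simp: mat_trace_def scalar_prod_def mat_adjoint_index lessThan_atLeast0 intro!: sum.cong)
    ultimately have "(\<Sum>i<n. \<Sum>j<n. (cmod (B $$ (i, j)))\<^sup>2) = 0"
      by (simp only: of_real_eq_0_iff)
    then have "B $$ (i, j) = 0" if "i < n" "j < n" for i j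
      using that by (simp add: sum_nonneg_eq_0_iff sum_nonneg)
    then show False using nz B by (metis (no_types, lifting) carrier_matD eq_matI index_zero_mat)
  qed
  then obtain c where "c \<in> set es" "c \<noteq> 0" by blast
  then have "eigenvalue B c"
    using eigenvalue_root_char_poly[OF B] es(1) by (auto simp: poly_prod_list prod_list_zero_iff)
  then obtain v where "eigenvector B v c" by (auto simp: eigenvalue_def)
  with that[of v c] \<open>c \<noteq> 0\<close> B show thesis by (auto simp: eigenvector_def)
qed

lemma cscalar_normalise:
  fixes v :: "complex vec"
  assumes v: "v \<in> carrier_vec n" and nz: "v \<noteq> 0\<^sub>v n"
  obtains c where "(c \<cdot>\<^sub>v v) \<bullet>c (c \<cdot>\<^sub>v v) = 1"
proof -
  define r where "r = (\<Sum>i<n. (cmod (v $ i))\<^sup>2)"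
  have vv: "v \<bullet>c v = complex_of_real r" unfolding r_def by (rule cscalar_self[OF v])
  have "r \<noteq> 0" using cscalar_self_zero[OF v] vv nz by auto
  moreover have "r \<ge> 0" by (simp add: r_def sum_nonneg)
  ultimately have r: "r > 0" by simp
  define t where "t = 1 / sqrt r"
  have t: "t * t * r = 1" using r by (simp add: t_def)
  have "(complex_of_real t \<cdot>\<^sub>v v) \<bullet>c (complex_of_real t \<cdot>\<^sub>v v) = complex_of_real (t * t * r)"
    using v vv by (simp add: cscalar_smult_left[of _ n] cscalar_smult_right[of _ n])
  then show thesis using t that by simp
qed

text \<open>The new eigenvector is one of the compression \<open>S A S\<close>, where \<open>S\<close> projects onto the complement of the old ones.\<close>

lemma orthonormal_eigenvectors_extend:
  fixes A :: "complex mat"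
  assumes A: "A \<in> carrier_mat n n" and herm: "mat_adjoint A = A" and k: "k < n"
    and q: "\<And>i. i < k \<Longrightarrow> q i \<in> carrier_vec n"
    and orth: "\<And>i j. i < k \<Longrightarrow> j < k \<Longrightarrow> q i \<bullet>c q j = (if i = j then 1 else 0)"
    and eig: "\<And>i. i < k \<Longrightarrow> A *\<^sub>v q i = d i \<cdot>\<^sub>v q i"
  obtains v c where "v \<in> carrier_vec n" "v \<bullet>c v = 1" "\<And>i. i < k \<Longrightarrow> v \<bullet>c q i = 0" "A *\<^sub>v v = c \<cdot>\<^sub>v v"
proof -
  \<comment> \<open>The columns of Q are the k eigenvectors already found, so P projects onto their
    span. The condition \<open>mat_adjoint Q *\<^sub>v v = 0\<^sub>v k\<close> below expresses
    orthogonality to all of them.\<close>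
  define Q where "Q = mat n k (\<lambda>(a, j). q j $ a)"
  define P where "P = Q * mat_adjoint Q"
  define S where "S = 1\<^sub>m n - P"
  define B where "B = S * A * S"
  have Q: "Q \<in> carrier_mat n k" by (simp add: Q_def)
  have Q': "mat_adjoint Q \<in> carrier_mat k n" using Q by simp
  have P: "P \<in> carrier_mat n n" using Q Q' by (simp add: P_def)
  have S: "S \<in> carrier_mat n n" using P by (simp add: S_def minus_carrier_mat)
  have B: "B \<in> carrier_mat n n" using S A by (simp add: B_def)
  have Q'v: "mat_adjoint Q *\<^sub>v v = vec k (\<lambda>i. v \<bullet>c q i)" if "v \<in> carrier_vec n" for v
  proof (rule eq_vecI)
    fix i assume "i < dim_vec (vec k (\<lambda>i. v \<bullet>c q i))"
    then have i: "i < k" by simp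
    then show "(mat_adjoint Q *\<^sub>v v) $ i = vec k (\<lambda>i. v \<bullet>c q i) $ i"
      using that unfolding index_vec[OF i] cscalar_sum[OF q[OF i]]
      by (auto simp: scalar_prod_def mat_adjoint_index Q_def lessThan_atLeast0 mult.commute intro!: sum.cong)
  qed (use Q in auto)
  have QQ: "mat_adjoint Q * Q = 1\<^sub>m k"
  proof (rule eq_matI)
    fix i j assume "i < dim_row (1\<^sub>m k)" "j < dim_col (1\<^sub>m k)"
    then have ij: "i < k" "j < k" by auto
    have "(mat_adjoint Q * Q) $$ (i, j) = q j \<bullet>c q i"
      using ij q unfolding cscalar_sum[OF q[OF ij(1)]]
      by (auto simp: scalar_prod_def mat_adjoint_index Q_def lessThan_atLeast0 mult.commute intro!: sum.cong)
    then show "(mat_adjoint Q * Q) $$ (i, j) = 1\<^sub>m k $$ (i, j)" using orth ij by auto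
  qed (use Q in auto)
  have P_adj: "mat_adjoint P = P"
    unfolding P_def using Q Q' by (simp add: adjoint_mult[of _ n k _ n])
  have S_adj: "mat_adjoint S = S"
    unfolding S_def using P P_adj by (simp add: adjoint_minus[of _ n n])
  have B_adj: "mat_adjoint B = B"
    unfolding B_def using S A S_adj herm
    by (simp add: adjoint_mult[of _ n n _ n] assoc_mult_mat[of _ n n _ n _ n])
  have Q'S: "mat_adjoint Q * S = 0\<^sub>m k n"
  proof -
    have "mat_adjoint Q * P = mat_adjoint Q * Q * mat_adjoint Q"
      unfolding P_def using Q Q' by (simp add: assoc_mult_mat[of _ k n _ k _ n])
    then have "mat_adjoint Q * P = mat_adjoint Q" using QQ left_mult_one_mat[OF Q'] by simp
    then show ?thesis unfolding S_def using Q' P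
      by (simp add: mult_minus_distrib_mat[of _ k n _ n] right_mult_one_mat[OF Q'] minus_r_inv_mat)
  qed
  have Sv: "S *\<^sub>v v = v" if "v \<in> carrier_vec n" "mat_adjoint Q *\<^sub>v v = 0\<^sub>v k" for v
  proof -
    have "P *\<^sub>v v = Q *\<^sub>v 0\<^sub>v k"
      unfolding P_def using Q Q' that by (simp add: assoc_mult_mat_vec[of _ n k _ n])
    then have "P *\<^sub>v v = 0\<^sub>v n" using Q by (auto intro!: eq_vecI)
    then show ?thesis unfolding S_def using P that by (simp add: minus_mult_distrib_mat_vec[of _ n n])
  qed
  \<comment> \<open>Since A is Hermitian, it maps the complement of a set of eigenvectors into
    itself; there S acts as the identity and B agrees with A.\<close>
  have Bv: "B *\<^sub>v v = A *\<^sub>v v" if v: "v \<in> carrier_vec n" and z: "mat_adjoint Q *\<^sub>v v = 0\<^sub>v k" for v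
  proof -
    have "(A *\<^sub>v v) \<bullet>c q i = 0" if i: "i < k" for i
    proof -
      have "(A *\<^sub>v v) \<bullet>c q i = cnj (d i) * (v \<bullet>c q i)"
        using cscalar_adjoint[OF A v q[OF i]] herm eig[OF i] cscalar_smult_right[OF v q[OF i]] by simp
      also have "v \<bullet>c q i = 0" using z i unfolding Q'v[OF v] by (metis index_vec index_zero_vec(1))
      finally show ?thesis by simp
    qed
    then have "mat_adjoint Q *\<^sub>v (A *\<^sub>v v) = 0\<^sub>v k"
      using A v by (subst Q'v) (auto intro!: eq_vecI)
    then have "S *\<^sub>v (A *\<^sub>v v) = A *\<^sub>v v" using A v by (intro Sv) auto
    then show ?thesis unfolding B_def using S A v Sv[OF v z]
      by (simp add: assoc_mult_mat_vec[of _ n n _ n])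
  qed
  have SB: "mat_adjoint Q *\<^sub>v (S *\<^sub>v u) = 0\<^sub>v k" if "u \<in> carrier_vec n" for u
  proof -
    have "mat_adjoint Q *\<^sub>v (S *\<^sub>v u) = (mat_adjoint Q * S) *\<^sub>v u"
      using Q' S that by (simp add: assoc_mult_mat_vec[of _ k n _ n])
    then show ?thesis using that unfolding Q'S by (auto intro!: eq_vecI)
  qed
  have "\<exists>v c. v \<in> carrier_vec n \<and> v \<noteq> 0\<^sub>v n \<and> mat_adjoint Q *\<^sub>v v = 0\<^sub>v k \<and> A *\<^sub>v v = c \<cdot>\<^sub>v v"
  proof (cases "B = 0\<^sub>m n n")
    \<comment> \<open>If the compression is zero, A vanishes on the whole complement, and any
      nonzero vector there will do. One exists because tr S = n - k is positive: a column of S with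
      nonzero diagonal entry.\<close>
    case True
    have "mat_trace S = of_nat n - of_nat k"
      unfolding S_def using P Q Q' QQ by (simp add: trace_minus[of _ n] P_def trace_comm[of Q n k])
    then have "mat_trace S \<noteq> 0" using k by simp
    then obtain i where i: "i < n" "S $$ (i, i) \<noteq> 0"
      using S by (metis (no_types, lifting) carrier_matD(1) lessThan_iff mat_trace_def sum.neutral)
    let ?w = "S *\<^sub>v unit_vec n i"
    have w: "?w \<in> carrier_vec n" using S by auto
    have "?w $ i = S $$ (i, i)" using S i cscalar_unit[of "row S i" n i] by simp
    then have "?w \<noteq> 0\<^sub>v n" using i by auto
    moreover have "mat_adjoint Q *\<^sub>v ?w = 0\<^sub>v k" by (rule SB) simp
    moreover have "A *\<^sub>v ?w = 0 \<cdot>\<^sub>v ?w"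
    proof -
      have "A *\<^sub>v ?w = 0\<^sub>v n"
        unfolding Bv[OF w SB[OF unit_vec_carrier], symmetric] True using w by (auto intro!: eq_vecI)
      also have "0\<^sub>v n = 0 \<cdot>\<^sub>v ?w" using carrier_vecD[OF w] by (intro eq_vecI) simp_all
      finally show ?thesis .
    qed
    ultimately show ?thesis using w by blast
  next
    case False
    obtain v c where v: "v \<in> carrier_vec n" "v \<noteq> 0\<^sub>v n" and c: "c \<noteq> 0" "B *\<^sub>v v = c \<cdot>\<^sub>v v"
      using hermitian_nonzero_eigenvector[OF B B_adj False] by blast
    \<comment> \<open>A nonzero eigenvalue is essential: dividing by c exhibits v as an element of
      the range of S, hence orthogonal to the old eigenvectors.\<close>
    have "S *\<^sub>v (inverse c \<cdot>\<^sub>v (A *\<^sub>v (S *\<^sub>v v))) = inverse c \<cdot>\<^sub>v (B *\<^sub>v v)"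
      unfolding B_def using S A v by (simp add: assoc_mult_mat_vec[of _ n n _ n] mult_mat_vec[of _ n n])
    also have "\<dots> = v" unfolding c(2) using c(1) v by (simp add: smult_smult_assoc)
    finally have z: "mat_adjoint Q *\<^sub>v v = 0\<^sub>v k"
      using SB[of "inverse c \<cdot>\<^sub>v (A *\<^sub>v (S *\<^sub>v v))"] A S v by simp
    then show ?thesis using v c Bv by metis
  qed
  then obtain v c where v: "v \<in> carrier_vec n" "v \<noteq> 0\<^sub>v n" "mat_adjoint Q *\<^sub>v v = 0\<^sub>v k" "A *\<^sub>v v = c \<cdot>\<^sub>v v"
    by blast
  obtain a where a: "(a \<cdot>\<^sub>v v) \<bullet>c (a \<cdot>\<^sub>v v) = 1" using cscalar_normalise[OF v(1,2)] .
  have "(a \<cdot>\<^sub>v v) \<bullet>c q i = 0" if i: "i < k" for i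
  proof -
    have "v \<bullet>c q i = 0" using v(3) i unfolding Q'v[OF v(1)] by (metis index_vec index_zero_vec(1))
    then show ?thesis using v q[OF i] by (simp add: cscalar_smult_left[of _ n])
  qed
  moreover have "A *\<^sub>v (a \<cdot>\<^sub>v v) = c \<cdot>\<^sub>v (a \<cdot>\<^sub>v v)"
    using A v by (simp add: mult_mat_vec[of _ n n] smult_smult_assoc mult.commute)
  ultimately show thesis using that[of "a \<cdot>\<^sub>v v" c] a v by auto
qed

lemma orthonormal_eigenvectors:
  fixes A :: "complex mat"
  assumes A: "A \<in> carrier_mat n n" and herm: "mat_adjoint A = A" and k: "k \<le> n"
  shows "\<exists>q d. (\<forall>i<k. q i \<in> carrier_vec n \<and> A *\<^sub>v q i = d i \<cdot>\<^sub>v q i) \<and>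
    (\<forall>i<k. \<forall>j<k. q i \<bullet>c q j = (if i = j then 1 else 0))"
  using k
proof (induction k)
  case 0
  then show ?case by simp
next
  case (Suc k)
  then obtain q d where qd: "\<forall>i<k. q i \<in> carrier_vec n \<and> A *\<^sub>v q i = d i \<cdot>\<^sub>v q i"
    "\<forall>i<k. \<forall>j<k. q i \<bullet>c q j = (if i = j then 1 else 0)"
    by (metis Suc_leD)
  then have q: "\<And>i. i < k \<Longrightarrow> q i \<in> carrier_vec n"
    "\<And>i. i < k \<Longrightarrow> A *\<^sub>v q i = d i \<cdot>\<^sub>v q i"
    "\<And>i j. i < k \<Longrightarrow> j < k \<Longrightarrow> q i \<bullet>c q j = (if i = j then 1 else 0)"
    by simp_all
  obtain v c where v: "v \<in> carrier_vec n" "v \<bullet>c v = 1" "\<And>i. i < k \<Longrightarrow> v \<bullet>c q i = 0" "A *\<^sub>v v = c \<cdot>\<^sub>v v"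
    using orthonormal_eigenvectors_extend[OF A herm Suc_le_lessD[OF Suc.prems] q(1) q(3) q(2)] by blast
  have v': "q i \<bullet>c v = 0" if "i < k" for i
    using cscalar_commute[OF v(1) q(1)[OF that]] v(3)[OF that] by simp
  show ?case
    by (rule exI[of _ "q(k := v)"], rule exI[of _ "d(k := c)"]) (use q v v' in \<open>auto simp: less_Suc_eq\<close>)
qed

text \<open>The last two conclusions keep the columns of Q as unit eigenvectors. They are what later
  gives the sign of each \<open>d i\<close> and its comparison with the smallest positive
  eigenvalue.\<close>

lemma hermitian_spectral:
  fixes A :: "complex mat"
  assumes A: "A \<in> carrier_mat n n" and herm: "mat_adjoint A = A"
  obtains Q d where "Q \<in> carrier_mat n n" "mat_adjoint Q * Q = 1\<^sub>m n" "Q * mat_adjoint Q = 1\<^sub>m n"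
    "A = Q * mat_diag n (\<lambda>i. complex_of_real (d i)) * mat_adjoint Q"
    "\<And>i. i < n \<Longrightarrow> col Q i \<bullet>c col Q i = 1"
    "\<And>i. i < n \<Longrightarrow> A *\<^sub>v col Q i = complex_of_real (d i) \<cdot>\<^sub>v col Q i"
proof -
  obtain q d where qd: "\<forall>i<n. q i \<in> carrier_vec n \<and> A *\<^sub>v q i = d i \<cdot>\<^sub>v q i"
    "\<forall>i<n. \<forall>j<n. q i \<bullet>c q j = (if i = j then 1 else 0)"
    using orthonormal_eigenvectors[OF A herm order.refl] by metis
  then have q: "\<And>i. i < n \<Longrightarrow> q i \<in> carrier_vec n"
    and eig: "\<And>i. i < n \<Longrightarrow> A *\<^sub>v q i = d i \<cdot>\<^sub>v q i"
    and orth: "\<And>i j. i < n \<Longrightarrow> j < n \<Longrightarrow> q i \<bullet>c q j = (if i = j then 1 else 0)"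
    by simp_all
  define Q where "Q = mat n n (\<lambda>(a, j). q j $ a)"
  \<comment> \<open>The eigenvalues come as complex numbers; hermiticity shows below that each
    equals its real part.\<close>
  define D where "D = mat_diag n (\<lambda>i. complex_of_real (Re (d i)))"
  have Q: "Q \<in> carrier_mat n n" by (simp add: Q_def)
  have Q': "mat_adjoint Q \<in> carrier_mat n n" using Q by simp
  have D: "D \<in> carrier_mat n n" by (simp add: D_def)
  have col: "col Q i = q i" if "i < n" for i
    using that q[OF that] by (intro eq_vecI) (auto simp: Q_def)
  have d: "complex_of_real (Re (d i)) = d i" if i: "i < n" for i
  proof -
    have "d i = (A *\<^sub>v q i) \<bullet>c q i" using eig orth q i by (simp add: cscalar_smult_left[of _ n])
    also have "\<dots> = q i \<bullet>c (A *\<^sub>v q i)" using cscalar_adjoint[OF A q q] herm i by simp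
    also have "\<dots> = cnj (d i)" using eig orth q i by (simp add: cscalar_smult_right[of _ n])
    finally have "Im (d i) = 0" by (simp add: complex_eq_iff)
    then show ?thesis by (simp add: complex_eq_iff)
  qed
  have QQ: "mat_adjoint Q * Q = 1\<^sub>m n"
  proof (rule eq_matI)
    fix i j assume "i < dim_row (1\<^sub>m n)" "j < dim_col (1\<^sub>m n)"
    then have ij: "i < n" "j < n" by auto
    have "(mat_adjoint Q * Q) $$ (i, j) = q j \<bullet>c q i"
      using ij q unfolding cscalar_sum[OF q[OF ij(1)]]
      by (auto simp: scalar_prod_def mat_adjoint_index Q_def lessThan_atLeast0 mult.commute intro!: sum.cong)
    then show "(mat_adjoint Q * Q) $$ (i, j) = 1\<^sub>m n $$ (i, j)" using orth ij by auto
  qed (use Q in auto)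
  have QQ': "Q * mat_adjoint Q = 1\<^sub>m n" by (rule mat_mult_left_right_inverse[OF Q' Q QQ])
  have "A * Q = Q * D"
  proof (rule eq_matI)
    fix i j assume "i < dim_row (Q * D)" "j < dim_col (Q * D)"
    then have ij: "i < n" "j < n" using Q D by auto
    have "(A * Q) $$ (i, j) = (A *\<^sub>v q j) $ i" using A Q ij col by simp
    also have "\<dots> = d j * q j $ i" using eig[OF ij(2)] q[OF ij(2)] ij by simp
    also have "\<dots> = (Q * D) $$ (i, j)"
      unfolding D_def using Q ij d by (subst mat_diag_mult_right[of _ n]) (auto simp: Q_def)
    finally show "(A * Q) $$ (i, j) = (Q * D) $$ (i, j)" .
  qed (use A Q D in auto)
  then have "Q * D * mat_adjoint Q = A * (Q * mat_adjoint Q)"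
    using A Q Q' by (simp add: assoc_mult_mat[of _ n n _ n _ n, symmetric])
  then have AQ: "A = Q * D * mat_adjoint Q" using A QQ' by simp
  show thesis
  proof (rule that[of Q "\<lambda>i. Re (d i)"])
    show "A = Q * mat_diag n (\<lambda>i. complex_of_real (Re (d i))) * mat_adjoint Q"
      using AQ by (simp only: D_def)
    show "col Q i \<bullet>c col Q i = 1" if "i < n" for i
      using orth[OF that that] col[OF that] by simp
    show "A *\<^sub>v col Q i = complex_of_real (Re (d i)) \<cdot>\<^sub>v col Q i" if "i < n" for i
      using eig[OF that] col[OF that] d[OF that] by simp
  qed (fact Q QQ QQ')+
qed

section \<open>Positive semidefinite matrices and the polar decomposition\<close>

text \<open>Associativity with dimensions instead of carriers as side conditions, so that the
  simplifier can rewrite with it without guessing intermediate sizes.\<close>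

lemma mat_assoc:
  fixes A B C :: "'a :: semiring_0 mat"
  assumes "dim_col A = dim_row B" "dim_col B = dim_row C"
  shows "A * B * C = A * (B * C)"
  using assms by (intro assoc_mult_mat[of _ "dim_row A" "dim_row B" _ "dim_row C" _ "dim_col C"]) auto

lemma mat_diag_dims [simp]: "dim_row (mat_diag n f) = n" "dim_col (mat_diag n f) = n"
  by (simp_all add: mat_diag_def)

section \<open>Calculus of matrices diagonalised by a fixed Q\<close>

lemma conj_diag_index:
  assumes "Q \<in> carrier_mat n n" "i < n" "j < n"
  shows "(Q * mat_diag n f * mat_adjoint Q) $$ (i, j) = (\<Sum>k<n. Q $$ (i, k) * f k * cnj (Q $$ (j, k)))"
  using assms unfolding mat_diag_mult_right[OF assms(1)]
  by (auto simp: scalar_prod_def mat_adjoint_index lessThan_atLeast0 intro!: sum.cong)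

lemma conj_diag_carrier:
  "Q \<in> carrier_mat n n \<Longrightarrow> Q * mat_diag n f * mat_adjoint Q \<in> carrier_mat n n"
  by auto

lemma conj_diag_mult:
  assumes Q: "Q \<in> carrier_mat n n" and QQ: "mat_adjoint Q * Q = 1\<^sub>m n"
  shows "(Q * mat_diag n f * mat_adjoint Q) * (Q * mat_diag n g * mat_adjoint Q)
    = Q * mat_diag n (\<lambda>i. f i * g i) * mat_adjoint Q"
proof -
  let ?F = "mat_diag n f" and ?G = "mat_diag n g"
  have GQ: "?G * mat_adjoint Q \<in> carrier_mat n n" using Q by auto
  have "mat_adjoint Q * (Q * (?G * mat_adjoint Q)) = (mat_adjoint Q * Q) * (?G * mat_adjoint Q)"
    using carrier_matD[OF Q] by (simp add: mat_assoc)
  also have "\<dots> = ?G * mat_adjoint Q" unfolding QQ using GQ by (rule left_mult_one_mat)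
  finally have "(Q * ?F * mat_adjoint Q) * (Q * ?G * mat_adjoint Q) = Q * (?F * (?G * mat_adjoint Q))"
    using carrier_matD[OF Q] by (simp add: mat_assoc)
  also have "\<dots> = Q * (?F * ?G) * mat_adjoint Q"
    using carrier_matD[OF Q] by (simp add: mat_assoc del: mat_diag_diag)
  finally show ?thesis by simp
qed

lemma conj_diag_trace:
  assumes Q: "Q \<in> carrier_mat n n" and QQ: "mat_adjoint Q * Q = 1\<^sub>m n"
  shows "mat_trace (Q * mat_diag n f * mat_adjoint Q) = (\<Sum>i<n. f i)"
proof -
  have Q': "mat_adjoint Q \<in> carrier_mat n n" using Q by simp
  have F: "mat_diag n f \<in> carrier_mat n n" by auto
  have "mat_trace (Q * mat_diag n f * mat_adjoint Q) = mat_trace (mat_adjoint Q * (Q * mat_diag n f))"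
    by (rule trace_comm[OF mult_carrier_mat[OF Q F] Q'])
  also have "mat_adjoint Q * (Q * mat_diag n f) = mat_diag n f"
    using assoc_mult_mat[OF Q' Q F] QQ left_mult_one_mat[OF F] by simp
  finally show ?thesis by (simp add: trace_diag)
qed

lemma conj_diag_adjoint:
  assumes Q: "Q \<in> carrier_mat n n"
  shows "mat_adjoint (Q * mat_diag n f * mat_adjoint Q) = Q * mat_diag n (\<lambda>i. cnj (f i)) * mat_adjoint Q"
proof (rule eq_matI)
  fix i j
  assume "i < dim_row (Q * mat_diag n (\<lambda>i. cnj (f i)) * mat_adjoint Q)"
    "j < dim_col (Q * mat_diag n (\<lambda>i. cnj (f i)) * mat_adjoint Q)"
  then have ij: "i < n" "j < n" using Q by auto
  then show "mat_adjoint (Q * mat_diag n f * mat_adjoint Q) $$ (i, j)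
      = (Q * mat_diag n (\<lambda>i. cnj (f i)) * mat_adjoint Q) $$ (i, j)"
    unfolding conj_diag_index[OF Q ij] using Q
    by (subst mat_adjoint_index)
      (auto simp: conj_diag_index[OF Q] mult_ac simp del: index_mult_mat(1) intro!: sum.cong)
qed (use Q in auto)

lemma conj_diag_minus:
  fixes Q :: "complex mat"
  assumes Q: "Q \<in> carrier_mat n n"
  shows "Q * mat_diag n f * mat_adjoint Q - c \<cdot>\<^sub>m (Q * mat_diag n g * mat_adjoint Q)
    = Q * mat_diag n (\<lambda>i. f i - c * g i) * mat_adjoint Q" (is "?L = ?R")
proof (rule eq_matI)
  fix i j assume "i < dim_row ?R" "j < dim_col ?R"
  then have ij: "i < n" "j < n" using Q by auto
  have "?L $$ (i, j) = (Q * mat_diag n f * mat_adjoint Q) $$ (i, j) - c * (Q * mat_diag n g * mat_adjoint Q) $$ (i, j)"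
    using ij Q by (simp del: index_mult_mat(1))
  then show "?L $$ (i, j) = ?R $$ (i, j)"
    unfolding conj_diag_index[OF Q ij]
    by (simp add: sum_distrib_left sum_subtractf[symmetric] algebra_simps)
qed (use Q in auto)

section \<open>Spectral criteria for positivity and trace inequalities\<close>

lemma psd_conj_diag:
  assumes Q: "Q \<in> carrier_mat n n" and d: "\<And>i. i < n \<Longrightarrow> 0 \<le> d i"
  shows "psd n (Q * mat_diag n (\<lambda>i. complex_of_real (d i)) * mat_adjoint Q)"
proof -
  let ?D = "mat_diag n (\<lambda>i. complex_of_real (d i))"
  have "psd n ?D" unfolding psd_def
  proof (intro conjI ballI)
    fix v :: "complex vec" assume v: "v \<in> carrier_vec n"
    have "?D *\<^sub>v v = vec n (\<lambda>i. complex_of_real (d i) * v $ i)"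
    proof (rule eq_vecI)
      fix i assume "i < dim_vec (vec n (\<lambda>i. complex_of_real (d i) * v $ i))"
      then have i: "i < n" by simp
      have "(?D *\<^sub>v v) $ i = (\<Sum>j<n. if j = i then complex_of_real (d i) * v $ i else 0)"
        unfolding mat_diag_def using i v
        by (subst index_mult_mat_vec) (auto simp: scalar_prod_def lessThan_atLeast0 simp del: sum.delta sum.delta' intro!: sum.cong)
      then show "(?D *\<^sub>v v) $ i = vec n (\<lambda>i. complex_of_real (d i) * v $ i) $ i" using i by simp
    qed (simp add: mat_diag_def)
    then have "(?D *\<^sub>v v) \<bullet>c v = (\<Sum>i<n. complex_of_real (d i * (cmod (v $ i))\<^sup>2))"
      unfolding of_real_mult complex_norm_square using v
      by (auto simp: cscalar_sum mult.assoc)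
    also have "\<dots> = complex_of_real (\<Sum>i<n. d i * (cmod (v $ i))\<^sup>2)" by simp
    also have "0 \<le> \<dots>" using d by (auto simp: less_eq_complex_def intro!: sum_nonneg)
    finally show "0 \<le> (?D *\<^sub>v v) \<bullet>c v" .
  qed auto
  from psd_congruence[OF this, of "mat_adjoint Q" n] Q show ?thesis by simp
qed

lemma psd_eigenvector_nonneg:
  assumes A: "psd n A" and v: "v \<in> carrier_vec n" "v \<bullet>c v = 1" and e: "A *\<^sub>v v = complex_of_real d \<cdot>\<^sub>v v"
  shows "0 \<le> d"
proof -
  have "0 \<le> (A *\<^sub>v v) \<bullet>c v" using A v by (simp add: psd_def)
  then show ?thesis using v by (simp add: e cscalar_smult_left[of _ n] less_eq_complex_def)
qed

lemma psd_spectral: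
  assumes A: "psd n A"
  obtains Q d where "Q \<in> carrier_mat n n" "mat_adjoint Q * Q = 1\<^sub>m n" "Q * mat_adjoint Q = 1\<^sub>m n"
    "A = Q * mat_diag n (\<lambda>i. complex_of_real (d i)) * mat_adjoint Q"
    "\<And>i. i < n \<Longrightarrow> 0 \<le> d i"
    "\<And>i. i < n \<Longrightarrow> col Q i \<bullet>c col Q i = 1"
    "\<And>i. i < n \<Longrightarrow> A *\<^sub>v col Q i = complex_of_real (d i) \<cdot>\<^sub>v col Q i"
proof -
  obtain Q d where Q: "Q \<in> carrier_mat n n" "mat_adjoint Q * Q = 1\<^sub>m n" "Q * mat_adjoint Q = 1\<^sub>m n"
    "A = Q * mat_diag n (\<lambda>i. complex_of_real (d i)) * mat_adjoint Q"
    and e: "\<And>i. i < n \<Longrightarrow> col Q i \<bullet>c col Q i = 1"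
    "\<And>i. i < n \<Longrightarrow> A *\<^sub>v col Q i = complex_of_real (d i) \<cdot>\<^sub>v col Q i"
    using hermitian_spectral[OF psd_carrier[OF A] psd_hermitian[OF A]] by blast
  have "0 \<le> d i" if "i < n" for i
    using psd_eigenvector_nonneg[OF A _ e(1)[OF that] e(2)[OF that]] Q(1) that by auto
  with that Q e show thesis by blast
qed

text \<open>Factor A as G G* with G = Q sqrt(D). Cyclicity turns tr (A B) into the trace of G* B G,
  a congruence of B.\<close>

lemma psd_trace_mult:
  assumes A: "psd n A" and B: "psd n B"
  shows "0 \<le> mat_trace (A * B)"
proof -
  obtain Q d where Q: "Q \<in> carrier_mat n n"
    and AQ: "A = Q * mat_diag n (\<lambda>i. complex_of_real (d i)) * mat_adjoint Q" and d: "\<And>i. i < n \<Longrightarrow> 0 \<le> d i"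
    using psd_spectral[OF A] by blast
  let ?S = "mat_diag n (\<lambda>i. complex_of_real (sqrt (d i)))"
  define G where "G = Q * ?S"
  have G: "G \<in> carrier_mat n n" using Q by (auto simp: G_def)
  have Bc: "B \<in> carrier_mat n n" using B by (rule psd_carrier)
  have S: "?S \<in> carrier_mat n n" by simp
  have "?S * ?S = mat_diag n (\<lambda>i. complex_of_real (d i))"
    unfolding mat_diag_diag using d
    by (intro eq_matI) (auto simp: mat_diag_def of_real_mult[symmetric] simp del: of_real_mult)
  then have "G * mat_adjoint G = A"
    unfolding AQ G_def using carrier_matD[OF Q]
    by (simp add: adjoint_mult[OF Q S] adjoint_diag mat_assoc del: mat_diag_diag)
       (simp add: mat_assoc[symmetric] del: mat_diag_diag)
  then have "mat_trace (A * B) = mat_trace (G * (mat_adjoint G * B))"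
    using carrier_matD[OF G] carrier_matD[OF Bc] by (simp add: mat_assoc[symmetric])
  also have "\<dots> = mat_trace (mat_adjoint G * B * G)"
    by (rule trace_comm[OF G mult_carrier_mat[OF adjoint_carrier[OF G] Bc]])
  finally show ?thesis using psd_trace[OF psd_congruence[OF B G]] by simp
qed

text \<open>For nonnegative eigenvalues the sum of the squares is at most the square of the
  sum.\<close>

lemma psd_trace_square_le:
  assumes A: "psd n A"
  shows "mat_trace (A * A) \<le> (mat_trace A)\<^sup>2"
proof -
  obtain Q d where Q: "Q \<in> carrier_mat n n" "mat_adjoint Q * Q = 1\<^sub>m n"
    and AQ: "A = Q * mat_diag n (\<lambda>i. complex_of_real (d i)) * mat_adjoint Q" and d: "\<And>i. i < n \<Longrightarrow> 0 \<le> d i"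
    using psd_spectral[OF A] by blast
  have "(\<Sum>i<n. d i * d i) \<le> (\<Sum>i<n. d i * (\<Sum>j<n. d j))"
    using d by (intro sum_mono mult_left_mono member_le_sum) auto
  also have "\<dots> = (\<Sum>i<n. d i)\<^sup>2" by (simp add: power2_eq_square sum_distrib_right)
  finally have "complex_of_real (\<Sum>i<n. d i * d i) \<le> complex_of_real ((\<Sum>i<n. d i)\<^sup>2)"
    by (simp only: less_eq_complex_def) simp
  then show ?thesis
    unfolding AQ conj_diag_mult[OF Q] conj_diag_trace[OF Q] by simp
qed

text \<open>Each eigenvalue d is zero or at least s, so d d - s d is nonnegative. Together with 0 <
  s, this operator inequality carries all the information about s that the later estimates
  use.\<close>

lemma psd_spectral_gap:
  assumes A: "psd n A" and s: "smallest_positive_eigenvalue A s"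
  shows "psd n (A * A - complex_of_real s \<cdot>\<^sub>m A)"
proof -
  obtain Q d where Q: "Q \<in> carrier_mat n n" "mat_adjoint Q * Q = 1\<^sub>m n"
    and AQ: "A = Q * mat_diag n (\<lambda>i. complex_of_real (d i)) * mat_adjoint Q"
    and d: "\<And>i. i < n \<Longrightarrow> 0 \<le> d i"
    and e: "\<And>i. i < n \<Longrightarrow> col Q i \<bullet>c col Q i = 1"
      "\<And>i. i < n \<Longrightarrow> A *\<^sub>v col Q i = complex_of_real (d i) \<cdot>\<^sub>v col Q i"
    using psd_spectral[OF A] by metis
  have nn: "0 \<le> d i * d i - s * d i" if i: "i < n" for i
  proof (cases "d i = 0")
    case False
    then have pos: "0 < d i" using d[OF i] by simp
    have c: "col Q i \<in> carrier_vec n" using Q(1) i by auto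
    have "col Q i \<noteq> 0\<^sub>v n" using e(1)[OF i] by auto
    then have "eigenvalue A (complex_of_real (d i))"
      unfolding eigenvalue_def eigenvector_def using c e(2)[OF i] psd_carrier[OF A]
      by (intro exI[of _ "col Q i"]) auto
    then have "s \<le> d i" using s pos by (auto simp: smallest_positive_eigenvalue_def)
    then show ?thesis using pos by (simp add: left_diff_distrib[symmetric])
  qed simp
  have "A * A - complex_of_real s \<cdot>\<^sub>m A
      = Q * mat_diag n (\<lambda>i. complex_of_real (d i * d i - s * d i)) * mat_adjoint Q"
    unfolding AQ conj_diag_mult[OF Q] conj_diag_minus[OF Q(1)] by simp
  then show ?thesis using psd_conj_diag[OF Q(1) nn] by simp
qed

text \<open>If \<open>(A - B) v = d v\<close> with \<open>d < 0\<close>, then \<open>B v = A v - d v\<close> would be longer than \<open>A v\<close>.\<close>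

lemma psd_minus_of_square:
  assumes A: "psd n A" and B: "psd n B" and le: "psd n (A * A - B * B)"
  shows "psd n (A - B)"
proof -
  have Ac: "A \<in> carrier_mat n n" and Bc: "B \<in> carrier_mat n n" using A B by (auto dest: psd_carrier)
  have C: "A - B \<in> carrier_mat n n" using Bc by (rule minus_carrier_mat)
  have "mat_adjoint (A - B) = A - B"
    using adjoint_minus[OF Ac Bc] psd_hermitian[OF A] psd_hermitian[OF B] by simp
  from hermitian_spectral[OF C this] obtain Q d where Q: "Q \<in> carrier_mat n n"
    and AB: "A - B = Q * mat_diag n (\<lambda>i. complex_of_real (d i)) * mat_adjoint Q"
    and e: "\<And>i. i < n \<Longrightarrow> col Q i \<bullet>c col Q i = 1"
      "\<And>i. i < n \<Longrightarrow> (A - B) *\<^sub>v col Q i = complex_of_real (d i) \<cdot>\<^sub>v col Q i"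
    by metis
  have "0 \<le> d i" if i: "i < n" for i
  proof (rule ccontr)
    assume neg: "\<not> 0 \<le> d i"
    define v where "v = col Q i"
    have v: "v \<in> carrier_vec n" using Q i by (auto simp: v_def)
    define a where "a = A *\<^sub>v v"
    define c where "c = complex_of_real (d i)"
    have a: "a \<in> carrier_vec n" using Ac v by (auto simp: a_def)
    have Bv: "B *\<^sub>v v = a - c \<cdot>\<^sub>v v"
    proof -
      have diff: "a - B *\<^sub>v v = c \<cdot>\<^sub>v v"
        using e(2)[OF i] Ac Bc v unfolding v_def[symmetric] c_def a_def
        by (simp add: minus_mult_distrib_mat_vec[of _ n n])
      have "B *\<^sub>v v = a - (a - B *\<^sub>v v)"
        using carrier_vecD[OF a] carrier_vecD[OF mult_mat_vec_carrier[OF Bc v]]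
        by (intro eq_vecI) (simp_all del: index_mult_mat_vec)
      then show ?thesis unfolding diff .
    qed
    have "0 \<le> ((A * A - B * B) *\<^sub>v v) \<bullet>c v" using le v by (simp add: psd_def)
    also have "((A * A - B * B) *\<^sub>v v) \<bullet>c v = a \<bullet>c a - (B *\<^sub>v v) \<bullet>c (B *\<^sub>v v)"
      using cscalar_gram[OF Ac v v] cscalar_gram[OF Bc v v] psd_hermitian[OF A] psd_hermitian[OF B] Ac Bc v
      by (simp add: minus_mult_distrib_mat_vec[of _ n n] cscalar_minus_left[of _ n] a_def)
    also have "\<dots> = c * (v \<bullet>c a) + c * (a \<bullet>c v) - c * c * (v \<bullet>c v)"
      unfolding Bv using a v
      by (simp add: cscalar_minus_left[of _ n] cscalar_minus_right[of _ n] cscalar_smult_left[of _ n]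
          cscalar_smult_right[of _ n] algebra_simps c_def)
    also have "v \<bullet>c v = 1" using e(1)[OF i] by (simp add: v_def)
    also have "v \<bullet>c a = cnj (a \<bullet>c v)" by (rule cscalar_commute[OF a v])
    \<comment> \<open>The difference of the squared lengths of A v and B v has become 2 d Re <A v,
      v> - d d. For d < 0 the first term is at most zero and the whole is negative.\<close>
    finally have "0 \<le> 2 * d i * Re (a \<bullet>c v) - d i * d i"
      by (simp add: less_eq_complex_def c_def)
    moreover have "0 \<le> Re (a \<bullet>c v)" using A v by (simp add: psd_def a_def less_eq_complex_def)
    then have "d i * Re (a \<bullet>c v) \<le> 0" using neg by (simp add: mult_nonpos_nonneg)
    moreover have "0 < d i * d i" using neg by (simp add: zero_less_mult_iff)
    ultimately show False by linarith
  qed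
  then show ?thesis unfolding AB by (rule psd_conj_diag[OF Q])
qed

section \<open>The polar decomposition\<close>

lemma gram_eq_zero:
  fixes X :: "complex mat"
  assumes X: "X \<in> carrier_mat m n" and z: "X * mat_adjoint X = 0\<^sub>m m m"
  shows "X = 0\<^sub>m m n"
proof (rule eq_matI)
  fix i j assume "i < dim_row (0\<^sub>m m n)" "j < dim_col (0\<^sub>m m n)"
  then have ij: "i < m" "j < n" by auto
  have "complex_of_real (\<Sum>k<n. (cmod (X $$ (i, k)))\<^sup>2) = (X * mat_adjoint X) $$ (i, i)"
    unfolding of_real_sum complex_norm_square using X ij
    by (auto simp: scalar_prod_def mat_adjoint_index lessThan_atLeast0 intro!: sum.cong)
  also have "\<dots> = 0" using z ij by simp
  finally have "(\<Sum>k<n. (cmod (X $$ (i, k)))\<^sup>2) = 0" by (simp only: of_real_eq_0_iff)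
  then show "X $$ (i, j) = 0\<^sub>m m n $$ (i, j)" using ij by (simp add: sum_nonneg_eq_0_iff)
qed (use X in auto)

text \<open>With H = T T*, take R = sqrt H, let G be the pseudo-inverse of R, and put W = T* G. Then
  T W = H G = R, and W* W is the projection onto the range of H. The last conclusion is kept because
  it later yields R R = T T*.\<close>

lemma polar_decomposition:
  assumes T: "T \<in> carrier_mat n m"
  obtains W R where "partial_isometry n m W" "psd n R" "T * W = R" "R * mat_adjoint W = T"
    "mat_adjoint W * W * R = R"
proof -
  have T': "mat_adjoint T \<in> carrier_mat m n" using T by simp
  define H where "H = T * mat_adjoint T"
  have psdH: "psd n H" using psd_gram[OF T'] by (simp add: H_def)
  obtain Q d where Q: "Q \<in> carrier_mat n n" "mat_adjoint Q * Q = 1\<^sub>m n"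
    and HQ: "H = Q * mat_diag n (\<lambda>i. complex_of_real (d i)) * mat_adjoint Q"
    and d: "\<And>i. i < n \<Longrightarrow> 0 \<le> d i"
    using psd_spectral[OF psdH] by metis
  \<comment> \<open>\<open>F f\<close> is f applied to H. Since the spectrum of H is nonnegative,
    identities among such matrices reduce to identities of functions on the nonnegative
    reals.\<close>
  define F where "F f = Q * mat_diag n (\<lambda>i. complex_of_real (f (d i))) * mat_adjoint Q" for f
  have F: "F f \<in> carrier_mat n n" for f unfolding F_def using Q(1) by (rule conj_diag_carrier)
  have F_mult: "F f * F g = F (\<lambda>x. f x * g x)" for f g
    unfolding F_def conj_diag_mult[OF Q] by simp
  have F_cong: "F f = F g" if "\<And>x. 0 \<le> x \<Longrightarrow> f x = g x" for f g
  proof -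
    have "mat_diag n (\<lambda>i. complex_of_real (f (d i))) = mat_diag n (\<lambda>i. complex_of_real (g (d i)))"
      using that d by (intro eq_matI) (auto simp: mat_diag_def)
    then show ?thesis by (simp add: F_def)
  qed
  have F_adj: "mat_adjoint (F f) = F f" for f
    unfolding F_def conj_diag_adjoint[OF Q(1)] by simp
  have H: "H = F (\<lambda>x. x)" by (simp add: F_def HQ)
  define R where "R = F sqrt"
  \<comment> \<open>As \<open>inverse 0 = 0\<close>, G inverts R on the range of H and vanishes on
    its kernel; the products of G and R are therefore the range projection P.\<close>
  define G where "G = F (\<lambda>x. inverse (sqrt x))"
  define P where "P = F (\<lambda>x. if x = 0 then 0 else 1)"
  define W where "W = mat_adjoint T * G"
  have R: "R \<in> carrier_mat n n" and G: "G \<in> carrier_mat n n" and P: "P \<in> carrier_mat n n"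
    using F by (auto simp: R_def G_def P_def)
  have W: "W \<in> carrier_mat m n" using T' G by (simp add: W_def)
  have W': "mat_adjoint W = G * T"
    using adjoint_mult[OF T' G] by (simp add: W_def G_def F_adj)
  note dims = carrier_matD[OF T] carrier_matD[OF R] carrier_matD[OF G] carrier_matD[OF P]
  have psdR: "psd n R"
    unfolding R_def F_def by (rule psd_conj_diag[OF Q(1)]) (simp add: d)
  have HG: "H * G = R"
    unfolding H G_def R_def F_mult by (rule F_cong) (auto simp: real_div_sqrt divide_inverse[symmetric])
  have RG: "R * G = P" and GR: "G * R = P" and PR: "P * R = R" and GP: "G * P = G"
    and PH: "P * H = H"
    unfolding G_def R_def P_def H F_mult by (rule F_cong; simp)+
  have TW: "T * W = R"
    using HG dims by (simp add: W_def H_def mat_assoc)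
  have PT: "P * T = T"
  proof -
    \<comment> \<open>K is the part of T outside the range of H. From K T* = H - P H = 0 it follows
      that K K* = 0, hence K = 0.\<close>
    define K where "K = T - P * T"
    have PTc: "P * T \<in> carrier_mat n m" using P T by auto
    have K: "K \<in> carrier_mat n m" unfolding K_def using PTc by (rule minus_carrier_mat)
    have "K * mat_adjoint T = H - P * H"
      unfolding K_def H_def using minus_mult_distrib_mat[OF T PTc T'] dims by (simp add: mat_assoc)
    also have "\<dots> = 0\<^sub>m n n" unfolding PH using psd_carrier[OF psdH] by auto
    finally have KT: "K * mat_adjoint T = 0\<^sub>m n n" .
    have "mat_adjoint K = mat_adjoint T - mat_adjoint T * P"
      unfolding K_def adjoint_minus[OF T PTc] adjoint_mult[OF P T] by (simp add: P_def F_adj)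
    then have "K * mat_adjoint K = K * mat_adjoint T - K * mat_adjoint T * P"
      using mult_minus_distrib_mat[OF K T' mult_carrier_mat[OF T' P]] dims carrier_matD[OF K]
      by (simp add: mat_assoc)
    also have "\<dots> = 0\<^sub>m n n" unfolding KT using P by auto
    finally have "K = 0\<^sub>m n m" by (rule gram_eq_zero[OF K])
    then have K0: "(T - P * T) $$ (i, j) = 0" if "i < n" "j < m" for i j using that by (simp add: K_def)
    show ?thesis
    proof (rule eq_matI)
      fix i j assume "i < dim_row T" "j < dim_col T"
      then show "(P * T) $$ (i, j) = T $$ (i, j)"
        using K0[of i j] dims by (simp del: index_mult_mat(1))
    qed (use dims in simp_all)
  qed
  have RW: "R * mat_adjoint W = T"
    unfolding W' using mat_assoc[of R G T] RG PT dims by simp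
  have WW: "mat_adjoint W * W = P"
  proof -
    have "mat_adjoint W * W = G * (T * W)" unfolding W' using dims carrier_matD[OF W] by (simp add: mat_assoc)
    then show ?thesis using TW GR by simp
  qed
  have WP: "W * P = W" unfolding W_def using dims GP by (simp add: mat_assoc)
  have "partial_isometry n m W" unfolding partial_isometry_def
  proof (intro conjI ballI impI)
    fix v :: "complex vec" assume v: "v \<in> carrier_vec n"
      and perp: "\<forall>u\<in>carrier_vec n. W *\<^sub>v u = 0\<^sub>v m \<longrightarrow> v \<bullet>c u = 0"
    \<comment> \<open>W P = W puts u in the kernel of W, so v is orthogonal to u and <P v, v> = <v,
      v>. Since W* W = P, the left side is the squared length of W v.\<close>
    define u where "u = v - P *\<^sub>v v"
    have Pv: "P *\<^sub>v v \<in> carrier_vec n" using P v by auto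
    have u: "u \<in> carrier_vec n" using v Pv by (auto simp: u_def)
    have "W *\<^sub>v u = W *\<^sub>v v - W *\<^sub>v (P *\<^sub>v v)"
      unfolding u_def by (rule mult_minus_distrib_mat_vec[OF W v Pv])
    also have "W *\<^sub>v (P *\<^sub>v v) = W *\<^sub>v v"
      using assoc_mult_mat_vec[OF W P v] WP by simp
    also have "W *\<^sub>v v - W *\<^sub>v v = 0\<^sub>v m" using mult_mat_vec_carrier[OF W v] by simp
    finally have "v \<bullet>c u = 0" using perp u by simp
    then have "u \<bullet>c v = 0" using cscalar_commute[OF v u] by simp
    then have "(P *\<^sub>v v) \<bullet>c v = v \<bullet>c v"
      unfolding u_def using cscalar_minus_left[OF v Pv v] by simp
    then show "(W *\<^sub>v v) \<bullet>c (W *\<^sub>v v) = v \<bullet>c v"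
      using cscalar_gram[OF W v v] WW by simp
  qed (rule W)
  then show thesis using that psdR TW RW WW PR by metis
qed

section \<open>The polar part of a contraction\<close>

lemma complex_nonneg_real: "0 \<le> (z::complex) \<Longrightarrow> z = complex_of_real (Re z)"
  by (simp add: less_eq_complex_def complex_eq_iff)

text \<open>W is the polar part of \<rho> B and r the trace of its positive part R. Apart from W
  only numbers survive in the conclusion, which leaves the scalar problem of
  \<open>fidelity_real_bound\<close>.\<close>

lemma polar_fidelity_bounds:
  assumes \<rho>: "psd n \<rho>" and tr: "mat_trace \<rho> = 1"
    and gap: "psd n (\<rho> * \<rho> - complex_of_real s \<cdot>\<^sub>m \<rho>)"
    and B: "B \<in> carrier_mat n m" and contr: "psd n (1\<^sub>m n - B * mat_adjoint B)"
  obtains W r b where "partial_isometry n m W"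
    "mat_trace (\<rho> * (B * W)) = complex_of_real r"
    "mat_trace (\<rho> * (B * mat_adjoint B)) = complex_of_real b"
    "b \<le> r" "r \<le> 1" "s * b \<le> r\<^sup>2" "s * (1 - 2 * r + b) \<le> (1 - r)\<^sup>2"
proof -
  have \<rho>c: "\<rho> \<in> carrier_mat n n" and \<rho>h: "mat_adjoint \<rho> = \<rho>"
    using \<rho> by (auto dest: psd_carrier psd_hermitian)
  have B': "mat_adjoint B \<in> carrier_mat m n" using B by simp
  have BB: "B * mat_adjoint B \<in> carrier_mat n n" using B by auto
  have psdBB: "psd n (B * mat_adjoint B)" using psd_gram[OF B'] by simp
  define T where "T = \<rho> * B"
  have T: "T \<in> carrier_mat n m" using \<rho>c B by (simp add: T_def)
  obtain W R where W: "partial_isometry n m W" and R: "psd n R" and TW: "T * W = R"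
    and RW: "R * mat_adjoint W = T" and WWR: "mat_adjoint W * W * R = R"
    using polar_decomposition[OF T] by metis
  have Wc: "W \<in> carrier_mat m n" using W by (simp add: partial_isometry_def)
  have Rc: "R \<in> carrier_mat n n" and Rh: "mat_adjoint R = R" using R by (auto dest: psd_carrier psd_hermitian)
  have W': "mat_adjoint W \<in> carrier_mat n m" using Wc by simp
  note dims = carrier_matD[OF \<rho>c] carrier_matD[OF B] carrier_matD[OF T] carrier_matD[OF Wc] carrier_matD[OF Rc]
  define r where "r = Re (mat_trace R)"
  define b where "b = Re (mat_trace (\<rho> * (B * mat_adjoint B)))"
  have r: "mat_trace R = complex_of_real r"
    unfolding r_def by (rule complex_nonneg_real[OF psd_trace[OF R]])
  have b: "mat_trace (\<rho> * (B * mat_adjoint B)) = complex_of_real b"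
    unfolding b_def by (rule complex_nonneg_real[OF psd_trace_mult[OF \<rho> psdBB]])
  have TB: "T * mat_adjoint B = \<rho> * (B * mat_adjoint B)" using dims by (simp add: T_def mat_assoc)
  have TB_c: "T * mat_adjoint B \<in> carrier_mat n n" using T B' by (rule mult_carrier_mat)
  have RWB: "R * (mat_adjoint W * mat_adjoint B) = T * mat_adjoint B"
    using dims mat_assoc[of R "mat_adjoint W" "mat_adjoint B"] RW by simp
  have T_adj: "mat_adjoint T = mat_adjoint B * \<rho>" unfolding T_def adjoint_mult[OF \<rho>c B] \<rho>h ..
  have T_adj': "mat_adjoint T = W * R" using adjoint_mult[OF Rc W'] Rh by (simp add: RW)
  \<comment> \<open>T = R W* and T* = W R, so T T* = R (W* W R) = R R.\<close>
  have RR: "R * R = \<rho> * (B * mat_adjoint B) * \<rho>"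
  proof -
    have "T * mat_adjoint T = R * (mat_adjoint W * W * R)"
      unfolding T_adj' using dims by (subst RW[symmetric]) (simp add: mat_assoc)
    moreover have "T * mat_adjoint T = \<rho> * (B * mat_adjoint B) * \<rho>"
      unfolding T_adj using dims by (simp add: T_def mat_assoc)
    ultimately show ?thesis using WWR by simp
  qed
  \<comment> \<open>Sandwiching 1 - B B* between two copies of \<rho> gives \<rho> \<rho> - R R, and
    positivity passes from the difference of squares to \<rho> - R.\<close>
  have \<rho>R: "psd n (\<rho> - R)"
  proof (rule psd_minus_of_square[OF \<rho> R])
    have "psd n (mat_adjoint \<rho> * (1\<^sub>m n - B * mat_adjoint B) * \<rho>)"
      by (rule psd_congruence[OF contr \<rho>c])
    also have "mat_adjoint \<rho> * (1\<^sub>m n - B * mat_adjoint B) * \<rho> = \<rho> * \<rho> - R * R"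
      unfolding RR \<rho>h mult_minus_distrib_mat[OF \<rho>c one_carrier_mat BB] right_mult_one_mat[OF \<rho>c]
      by (rule minus_mult_distrib_mat[OF \<rho>c mult_carrier_mat[OF \<rho>c BB] \<rho>c])
    finally show "psd n (\<rho> * \<rho> - R * R)" .
  qed
  have tr\<rho>R: "mat_trace (\<rho> - R) = complex_of_real (1 - r)"
    using trace_minus[OF \<rho>c Rc] tr r by simp
  have r1: "r \<le> 1" using psd_trace[OF \<rho>R] unfolding tr\<rho>R by (simp add: less_eq_complex_def)
  have br: "b \<le> r"
  proof -
    \<comment> \<open>The trace of X* R X expands to r - 2 b plus the trace of R B B*. It is
      nonnegative, and the trace of R B B* is at most r because B B* is at most the identity;
      together 2 b is at most 2 r.\<close>
    define X where "X = mat_adjoint W - B"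
    have X: "X \<in> carrier_mat n m" unfolding X_def using B by (rule minus_carrier_mat)
    have X_adj: "mat_adjoint X = W - mat_adjoint B" unfolding X_def adjoint_minus[OF W' B] by simp
    have X': "mat_adjoint X \<in> carrier_mat m n" using X by simp
    have RX: "R * X = T - R * B" unfolding X_def mult_minus_distrib_mat[OF Rc W' B] RW ..
    have RB: "R * B \<in> carrier_mat n m" using Rc B by (rule mult_carrier_mat)
    have "0 \<le> mat_trace (mat_adjoint X * R * X)" by (rule psd_trace[OF psd_congruence[OF R X]])
    also have "mat_adjoint X * R * X = mat_adjoint X * (R * X)"
      using dims carrier_matD[OF X] by (simp add: mat_assoc)
    also have "mat_trace \<dots> = mat_trace ((T - R * B) * mat_adjoint X)"
      unfolding RX[symmetric] by (rule trace_comm[OF X' mult_carrier_mat[OF Rc X]])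
    also have "(T - R * B) * mat_adjoint X = (R - R * B * W) - (T * mat_adjoint B - R * (B * mat_adjoint B))"
    proof -
      have "(T - R * B) * mat_adjoint X = (T - R * B) * W - (T - R * B) * mat_adjoint B"
        unfolding X_adj by (rule mult_minus_distrib_mat[OF minus_carrier_mat[OF RB] Wc B'])
      also have "(T - R * B) * W = R - R * B * W"
        unfolding minus_mult_distrib_mat[OF T RB Wc] TW ..
      also have "(T - R * B) * mat_adjoint B = T * mat_adjoint B - R * (B * mat_adjoint B)"
        unfolding minus_mult_distrib_mat[OF T RB B'] using dims by (simp add: mat_assoc)
      finally show ?thesis .
    qed
    also have "mat_trace \<dots> = mat_trace R - mat_trace (R * B * W) - (mat_trace (T * mat_adjoint B) - mat_trace (R * (B * mat_adjoint B)))"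
      using trace_minus[OF minus_carrier_mat[OF mult_carrier_mat[OF RB Wc]] minus_carrier_mat[OF mult_carrier_mat[OF Rc BB]], of R "T * mat_adjoint B"]
        trace_minus[OF Rc mult_carrier_mat[OF RB Wc]] trace_minus[OF TB_c mult_carrier_mat[OF Rc BB]]
      by simp
    also have "mat_trace (R * B * W) = complex_of_real b"
    proof -
      have WB: "mat_adjoint W * mat_adjoint B \<in> carrier_mat n n" using W' B' by (rule mult_carrier_mat)
      have BW: "B * W \<in> carrier_mat n n" using B Wc by (rule mult_carrier_mat)
      have "mat_adjoint (R * (mat_adjoint W * mat_adjoint B)) = B * W * R"
        unfolding adjoint_mult[OF Rc WB] adjoint_mult[OF W' B'] Rh by simp
      then have "mat_trace (B * W * R) = cnj (complex_of_real b)"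
        using trace_adjoint[OF TB_c] b RWB TB by simp
      moreover have "mat_trace (R * B * W) = mat_trace (B * W * R)"
        using trace_comm[OF Rc BW] dims by (simp add: mat_assoc)
      ultimately show ?thesis by simp
    qed
    finally have "0 \<le> complex_of_real r - complex_of_real b - (complex_of_real b - mat_trace (R * (B * mat_adjoint B)))"
      using TB b r by simp
    moreover have "0 \<le> mat_trace (R * (1\<^sub>m n - B * mat_adjoint B))" by (rule psd_trace_mult[OF R contr])
    then have "0 \<le> complex_of_real r - mat_trace (R * (B * mat_adjoint B))"
      unfolding mult_minus_distrib_mat[OF Rc one_carrier_mat BB] right_mult_one_mat[OF Rc]
        trace_minus[OF Rc mult_carrier_mat[OF Rc BB]] r .
    ultimately show ?thesis by (simp add: less_eq_complex_def)
  qed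
  \<comment> \<open>The spectral gap tested against a positive Y. It is applied to B B* for
    \<open>sb\<close> and to (1 - B W) times its adjoint for \<open>sd\<close>.\<close>
  have gap_le: "s * x \<le> y"
    if Y: "psd n Y" and x: "mat_trace (\<rho> * Y) = complex_of_real x" and y: "mat_trace (\<rho> * \<rho> * Y) \<le> complex_of_real y" for Y x y
  proof -
    have Yc: "Y \<in> carrier_mat n n" using Y by (rule psd_carrier)
    have \<rho>2: "\<rho> * \<rho> \<in> carrier_mat n n" using \<rho>c by auto
    have "0 \<le> mat_trace ((\<rho> * \<rho> - complex_of_real s \<cdot>\<^sub>m \<rho>) * Y)" by (rule psd_trace_mult[OF gap Y])
    also have "(\<rho> * \<rho> - complex_of_real s \<cdot>\<^sub>m \<rho>) * Y = \<rho> * \<rho> * Y - complex_of_real s \<cdot>\<^sub>m (\<rho> * Y)"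
      unfolding minus_mult_distrib_mat[OF \<rho>2 smult_carrier_mat[OF \<rho>c] Yc] mult_smult_assoc_mat[OF \<rho>c Yc] ..
    also have "mat_trace \<dots> = mat_trace (\<rho> * \<rho> * Y) - complex_of_real (s * x)"
      using trace_minus[OF mult_carrier_mat[OF \<rho>2 Yc] smult_carrier_mat[OF mult_carrier_mat[OF \<rho>c Yc]]]
        trace_smult[OF mult_carrier_mat[OF \<rho>c Yc]] x by simp
    finally show ?thesis using y by (simp add: less_eq_complex_def)
  qed
  have sb: "s * b \<le> r\<^sup>2"
  proof (rule gap_le[OF psdBB b])
    have "mat_trace (\<rho> * \<rho> * (B * mat_adjoint B)) = mat_trace (R * R)"
      unfolding RR using trace_comm[OF \<rho>c mult_carrier_mat[OF \<rho>c BB]] dims by (simp add: mat_assoc)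
    also have "\<dots> \<le> (mat_trace R)\<^sup>2" by (rule psd_trace_square_le[OF R])
    finally show "mat_trace (\<rho> * \<rho> * (B * mat_adjoint B)) \<le> complex_of_real (r\<^sup>2)" using r by simp
  qed
  have sd: "s * (1 - 2 * r + b) \<le> (1 - r)\<^sup>2"
  proof -
    define X where "X = B * W"
    define Y where "Y = 1\<^sub>m n - X"
    have X: "X \<in> carrier_mat n n" unfolding X_def using B Wc by (rule mult_carrier_mat)
    have Y: "Y \<in> carrier_mat n n" unfolding Y_def using X by (rule minus_carrier_mat)
    have X': "mat_adjoint X \<in> carrier_mat n n" and Y': "mat_adjoint Y \<in> carrier_mat n n" using X Y by auto
    have X_adj: "mat_adjoint X = mat_adjoint W * mat_adjoint B" unfolding X_def by (rule adjoint_mult[OF B Wc])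
    have Y_adj: "mat_adjoint Y = 1\<^sub>m n - mat_adjoint X" unfolding Y_def adjoint_minus[OF one_carrier_mat X] by simp
    have \<rho>X: "\<rho> * X = R" unfolding X_def using TW dims by (simp add: T_def mat_assoc)
    have \<rho>Y: "\<rho> * Y = \<rho> - R"
      unfolding Y_def mult_minus_distrib_mat[OF \<rho>c one_carrier_mat X] \<rho>X using \<rho>c by simp
    have \<rho>YY: "\<rho> * (Y * mat_adjoint Y) = \<rho> * Y * mat_adjoint Y"
      using dims carrier_matD[OF Y] by (simp add: mat_assoc)
    have psdYY: "psd n (Y * mat_adjoint Y)" using psd_gram[OF Y'] by simp
    have \<rho>Rc: "\<rho> - R \<in> carrier_mat n n" using Rc by (rule minus_carrier_mat)
    have "mat_trace (\<rho> * (Y * mat_adjoint Y)) = complex_of_real (1 - 2 * r + b)"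
    proof -
      have "\<rho> * (Y * mat_adjoint Y) = (\<rho> - R) - (\<rho> * mat_adjoint X - R * mat_adjoint X)"
        unfolding \<rho>YY unfolding \<rho>Y Y_adj mult_minus_distrib_mat[OF \<rho>Rc one_carrier_mat X']
          minus_mult_distrib_mat[OF \<rho>c Rc X'] right_mult_one_mat[OF \<rho>Rc] ..
      moreover have "mat_trace (\<rho> * mat_adjoint X) = complex_of_real r"
      proof -
        have "mat_trace (\<rho> * mat_adjoint X) = mat_trace (mat_adjoint (X * \<rho>))"
          unfolding adjoint_mult[OF X \<rho>c] \<rho>h ..
        also have "\<dots> = cnj (mat_trace (\<rho> * X))"
          unfolding trace_adjoint[OF mult_carrier_mat[OF X \<rho>c]] trace_comm[OF X \<rho>c] ..
        finally show ?thesis unfolding \<rho>X r by simp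
      qed
      moreover have "mat_trace (R * mat_adjoint X) = complex_of_real b"
        unfolding X_adj RWB TB b ..
      ultimately show ?thesis
        using trace_minus[OF \<rho>Rc minus_carrier_mat[OF mult_carrier_mat[OF Rc X']]] tr\<rho>R
          trace_minus[OF mult_carrier_mat[OF \<rho>c X'] mult_carrier_mat[OF Rc X']]
        by simp
    qed
    then show ?thesis
    proof (rule gap_le[OF psdYY])
      \<comment> \<open>\<rho> Y = \<rho> - R is Hermitian and so equals its adjoint Y* \<rho>. This
        turns the trace of \<rho> \<rho> Y Y* into that of the square of \<rho> - R.\<close>
      have "(\<rho> - R) = mat_adjoint Y * \<rho>"
        using psd_hermitian[OF \<rho>R] adjoint_mult[OF \<rho>c Y] \<rho>h \<rho>Y by simp
      then have "(\<rho> - R) * (\<rho> - R) = \<rho> * Y * (mat_adjoint Y * \<rho>)" using \<rho>Y by simp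
      then have "mat_trace (\<rho> * \<rho> * (Y * mat_adjoint Y)) = mat_trace ((\<rho> - R) * (\<rho> - R))"
        using trace_comm[OF \<rho>c mult_carrier_mat[OF \<rho>c mult_carrier_mat[OF Y Y']]] dims carrier_matD[OF Y]
        by (simp add: mat_assoc)
      also have "\<dots> \<le> (mat_trace (\<rho> - R))\<^sup>2" by (rule psd_trace_square_le[OF \<rho>R])
      finally show "mat_trace (\<rho> * \<rho> * (Y * mat_adjoint Y)) \<le> complex_of_real ((1 - r)\<^sup>2)"
        unfolding tr\<rho>R by simp
    qed
  qed
  have "mat_trace (\<rho> * (B * W)) = complex_of_real r"
    using TW r dims by (simp add: T_def mat_assoc)
  from that[OF W this b br r1 sb sd] show thesis .
qed

section \<open>The scalar inequality\<close>

lemma fidelity_real_bound: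
  fixes s F r b :: real
  assumes s: "0 < s" "s \<le> 1" and F: "0 \<le> F" "F \<le> b" "b \<le> r" "r \<le> 1"
    and sb: "s * b \<le> r\<^sup>2" and sd: "s * (1 - 2 * r + b) \<le> (1 - r)\<^sup>2" and \<epsilon>: "\<epsilon> = 1 - F"
  shows "1 - r\<^sup>2 - \<epsilon> \<le> (if \<epsilon> \<le> s then (1 / s - 1) * (ell s \<epsilon>)\<^sup>2 else (1 - \<epsilon>) * min \<epsilon> (1 - s))"
proof (cases "\<epsilon> \<le> s")
  case True
  \<comment> \<open>As a condition on x = 1 - r, the hypothesis \<open>sd\<close> with b lowered to
    F says that x^2 - 2 s x + s \<epsilon> is nonnegative. Its roots are s (1 - w) and s (1 + w),
    and t is the smaller one.\<close>
  define w where "w = sqrt (1 - \<epsilon> / s)"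
  have w0: "0 \<le> w" and w2: "w\<^sup>2 = 1 - \<epsilon> / s" using True s by (auto simp: w_def)
  define t where "t = s * (1 - w)"
  have eps: "\<epsilon> = s * (1 - w\<^sup>2)" using w2 s by (simp add: field_simps)
  \<comment> \<open>The denominator in \<open>ell\<close> is the rationalised form of the root: t (1
    + w) = s (1 - w^2) = \<epsilon>.\<close>
  have "ell s \<epsilon> = t"
  proof -
    have "\<epsilon> = t * (1 + w)" unfolding eps by (simp add: t_def power2_eq_square algebra_simps)
    then have "\<epsilon> / (1 + w) = t" using w0 by simp
    then show ?thesis by (simp add: ell_def w_def)
  qed
  have t_le: "t \<le> s" using w0 s by (simp add: t_def mult_le_cancel_left1)
  have "s * (1 - 2 * r + (1 - \<epsilon>)) \<le> (1 - r)\<^sup>2"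
    using mult_left_mono[of "1 - 2 * r + (1 - \<epsilon>)" "1 - 2 * r + b" s] s F \<epsilon> sd by linarith
  then have "(s * w)\<^sup>2 \<le> (s - (1 - r))\<^sup>2"
    unfolding eps by (simp add: power2_eq_square algebra_simps)
  then have "s * w \<le> \<bar>s - (1 - r)\<bar>" using w0 s by (metis abs_le_square_iff abs_of_nonneg mult_nonneg_nonneg less_imp_le)
  \<comment> \<open>The chain 1 - r \<le> 1 - F = \<epsilon> \<le> s excludes the branch beyond the
    larger root, so 1 - r is at most t.\<close>
  moreover have "1 - r \<le> s" using True \<epsilon> F by linarith
  ultimately have "1 - t \<le> r" by (simp add: t_def algebra_simps)
  moreover have "0 \<le> 1 - t" using t_le s by linarith
  ultimately have "(1 - t)\<^sup>2 \<le> r\<^sup>2" by (intro power_mono)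
  \<comment> \<open>Here w = 1 - t / s, hence \<epsilon> = t (1 + w) = 2 t - t^2 / s.\<close>
  moreover have "1 - (1 - t)\<^sup>2 - \<epsilon> = (1 / s - 1) * t\<^sup>2"
    unfolding eps t_def using s by (simp add: field_simps power2_eq_square)
  ultimately show ?thesis using True \<open>ell s \<epsilon> = t\<close> by simp
next
  case False
  \<comment> \<open>The left side of the goal is F - r^2. The lower bounds F^2 and s F for r^2
    produce the two entries of the minimum.\<close>
  have "F\<^sup>2 \<le> r\<^sup>2" using F by (intro power_mono) auto
  moreover have "s * F \<le> r\<^sup>2" using mult_left_mono[of F b s] s F sb by linarith
  ultimately have "1 - r\<^sup>2 - \<epsilon> \<le> (1 - \<epsilon>) * \<epsilon>" "1 - r\<^sup>2 - \<epsilon> \<le> (1 - \<epsilon>) * (1 - s)"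
    unfolding \<epsilon> by (auto simp: power2_eq_square algebra_simps)
  then show ?thesis using False by (simp add: min_def)
qed

section \<open>Kraus operators\<close>

lemma mat_sum_Cons: "mat_sum m n (A # As) = A + mat_sum m n As"
  by (simp add: mat_sum_def)

lemma mat_sum_Nil: "mat_sum m n [] = 0\<^sub>m m n"
  by (simp add: mat_sum_def)

lemma mat_sum_append:
  assumes "set As \<subseteq> carrier_mat m n" "set Bs \<subseteq> carrier_mat m n"
  shows "mat_sum m n (As @ Bs) = mat_sum m n As + mat_sum m n Bs"
  using assms(1)
proof (induction As)
  case Nil
  then show ?case using mat_sum_dims[OF assms(2)] by (simp add: mat_sum_Nil)
next
  case (Cons A As)
  have "mat_sum m n As \<in> carrier_mat m n" using Cons.prems by (intro mat_sum_dims) auto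
  then show ?case using Cons mat_sum_dims[OF assms(2)]
    by (simp add: mat_sum_Cons assoc_add_mat[of _ m n])
qed

lemma linear_map_compose:
  assumes "linear_map n m \<Phi>" "linear_map m l \<Psi>"
  shows "linear_map n l (\<Psi> \<circ> \<Phi>)"
  using assms unfolding linear_map_def by simp

lemma linear_map_mat_sum:
  assumes \<Psi>: "linear_map n m \<Psi>" and X: "set Xs \<subseteq> carrier_mat n n"
  shows "\<Psi> (mat_sum n n Xs) = mat_sum m m (map \<Psi> Xs)"
  using X
proof (induction Xs)
  case Nil
  have "(0\<^sub>m n n :: complex mat) = 0 \<cdot>\<^sub>m 0\<^sub>m n n" by (intro eq_matI) auto
  then have "\<Psi> (0\<^sub>m n n) = 0 \<cdot>\<^sub>m \<Psi> (0\<^sub>m n n)"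
    using \<Psi> unfolding linear_map_def by (metis zero_carrier_mat)
  also have "\<dots> = 0\<^sub>m m m"
  proof -
    have "\<Psi> (0\<^sub>m n n) \<in> carrier_mat m m" using \<Psi> unfolding linear_map_def by simp
    then show ?thesis by (intro eq_matI) auto
  qed
  finally show ?case by (simp add: mat_sum_Nil)
next
  case (Cons X Xs)
  have "mat_sum n n Xs \<in> carrier_mat n n" using Cons.prems by (intro mat_sum_dims) auto
  then show ?case using Cons \<Psi> unfolding linear_map_def by (simp add: mat_sum_Cons)
qed

text \<open>The products are listed with K outermost, so that sums over them unfold to nested sums,
  first over the inner map and then over the outer one.\<close>

lemma kraus_compose:
  assumes \<Phi>: "kraus_operators n m \<Phi> Ks" and \<Psi>: "kraus_operators m l \<Psi> Js" and lin: "linear_map m l \<Psi>"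
  shows "kraus_operators n l (\<Psi> \<circ> \<Phi>) (concat (map (\<lambda>K. map (\<lambda>J. J * K) Js) Ks))"
  unfolding kraus_operators_def
proof (intro conjI ballI)
  have Kc: "set Ks \<subseteq> carrier_mat m n" and Jc: "set Js \<subseteq> carrier_mat l m"
    using \<Phi> \<Psi> by (auto simp: kraus_operators_def)
  show "set (concat (map (\<lambda>K. map (\<lambda>J. J * K) Js) Ks)) \<subseteq> carrier_mat l n"
    using Kc Jc by (auto intro!: mult_carrier_mat[of _ l m])
  fix X :: "complex mat" assume X: "X \<in> carrier_mat n n"
  let ?F = "\<lambda>K. K * X * mat_adjoint K"
  have F: "?F K \<in> carrier_mat m m" if "K \<in> set Ks" for K
    using subsetD[OF Kc that] X by (metis adjoint_carrier mult_carrier_mat)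
  have "(\<Psi> \<circ> \<Phi>) X = mat_sum l l (map (\<lambda>K. \<Psi> (?F K)) Ks)"
    using \<Phi> X linear_map_mat_sum[OF lin, of "map ?F Ks"] F
    by (auto simp: kraus_operators_def o_def image_subset_iff)
  also have "\<dots> = mat_sum l l (map ?F (concat (map (\<lambda>K. map (\<lambda>J. J * K) Js) Ks)))"
    using Kc
  proof (induction Ks)
    case Nil
    then show ?case by simp
  next
    case (Cons K Ks)
    have K: "K \<in> carrier_mat m n" using Cons.prems by simp
    have eq: "map (\<lambda>J. J * (?F K) * mat_adjoint J) Js = map ?F (map (\<lambda>J. J * K) Js)"
    proof -
      have "J * ?F K * mat_adjoint J = J * K * X * mat_adjoint (J * K)" if "J \<in> set Js" for J
      proof -
        have J: "J \<in> carrier_mat l m" using that Jc by auto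
        show ?thesis
          unfolding adjoint_mult[OF J K] using carrier_matD[OF J] carrier_matD[OF K] carrier_matD[OF X]
          by (simp add: mat_assoc)
      qed
      then show ?thesis by simp
    qed
    have c1: "set (map ?F (map (\<lambda>J. J * K) Js)) \<subseteq> carrier_mat l l"
      using Jc unfolding eq[symmetric]
      by (auto intro!: mult_carrier_mat[of _ l m] mult_carrier_mat[of _ m n] X K)
    have c2: "set (map ?F (concat (map (\<lambda>K. map (\<lambda>J. J * K) Js) Ks))) \<subseteq> carrier_mat l l"
    proof -
      have "?F (J * K') \<in> carrier_mat l l" if "K' \<in> set Ks" "J \<in> set Js" for K' J
      proof -
        have "J * K' \<in> carrier_mat l n"
          using that Jc Cons.prems by (intro mult_carrier_mat[of _ l m]) auto
        then show ?thesis using X by (metis adjoint_carrier mult_carrier_mat)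
      qed
      then show ?thesis by auto
    qed
    have "?F K \<in> carrier_mat m m" using K X by auto
    then have "\<Psi> (?F K) = mat_sum l l (map ?F (map (\<lambda>J. J * K) Js))"
      using \<Psi> unfolding eq[symmetric] by (simp add: kraus_operators_def)
    then show ?case using Cons mat_sum_append[OF c1 c2] by (simp add: mat_sum_Cons)
  qed
  finally show "(\<Psi> \<circ> \<Phi>) X = mat_sum l l (map ?F (concat (map (\<lambda>K. map (\<lambda>J. J * K) Js) Ks)))" .
qed

lemma kraus_conjugation:
  assumes W: "W \<in> carrier_mat m n"
  shows "kraus_operators n m (\<lambda>\<omega>. W * \<omega> * mat_adjoint W) [W]"
  using W by (auto simp: kraus_operators_def mat_sum_Cons mat_sum_Nil intro!: right_add_zero_mat[symmetric])

text \<open>One formula for both fidelities of the theorem: Ks is either a Kraus family of \<C> or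
  the single operator W, while Js is a Kraus family of \<A>.\<close>

lemma fidelity_compose:
  assumes \<rho>: "\<rho> \<in> carrier_mat n n" and \<Phi>: "kraus_operators n m \<Phi> Ks"
    and \<Psi>: "kraus_operators m n \<Psi> Js" "linear_map m n \<Psi>"
  shows "entanglement_fidelity n \<rho> (\<Psi> \<circ> \<Phi>) = (\<Sum>K\<leftarrow>Ks. \<Sum>J\<leftarrow>Js. (cmod (mat_trace (\<rho> * (J * K))))\<^sup>2)"
proof -
  have "sum_list (map f (concat (map (\<lambda>K. map (\<lambda>J. J * K) Js) Ks))) = (\<Sum>K\<leftarrow>Ks. \<Sum>J\<leftarrow>Js. f (J * K))"
    for f :: "complex mat \<Rightarrow> real"
    by (induction Ks) (simp_all add: o_def)
  then show ?thesis
    unfolding entanglement_fidelity_kraus[OF \<rho> kraus_compose[OF \<Phi> \<Psi>]] .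
qed

section \<open>Contractive families of operators and their unit combinations\<close>

definition sqnorm :: "complex vec \<Rightarrow> real" where
  "sqnorm v = (\<Sum>i<dim_vec v. (cmod (v $ i))\<^sup>2)"

lemma sqnorm_nonneg: "0 \<le> sqnorm v"
  by (simp add: sqnorm_def sum_nonneg)

lemma cscalar_self_sqnorm: "v \<bullet>c v = complex_of_real (sqnorm v)"
  unfolding sqnorm_def by (rule cscalar_self) simp

text \<open>The form of the sum of K* K at v is the sum of the squared lengths of K v. In this shape
  the bound passes easily to compositions and to linear combinations.\<close>

lemma kraus_contraction:
  assumes Ks: "set Ks \<subseteq> carrier_mat m n"
    and le: "loewner_le n (mat_sum n n (map (\<lambda>K. mat_adjoint K * K) Ks)) (1\<^sub>m n)"
    and v: "v \<in> carrier_vec n"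
  shows "(\<Sum>K\<leftarrow>Ks. sqnorm (K *\<^sub>v v)) \<le> sqnorm v"
proof -
  let ?S = "\<lambda>Ks. mat_sum n n (map (\<lambda>K. mat_adjoint K * K) Ks)"
  have S: "?S Ks \<in> carrier_mat n n" if "set Ks \<subseteq> carrier_mat m n" for Ks
    using that by (intro mat_sum_dims) (auto intro!: mult_carrier_mat[of _ n m])
  have eq: "(?S Ks *\<^sub>v v) \<bullet>c v = complex_of_real (\<Sum>K\<leftarrow>Ks. sqnorm (K *\<^sub>v v))"
    using Ks
  proof (induction Ks)
    case Nil
    have "0\<^sub>m n n *\<^sub>v v = 0\<^sub>v n" using v by (intro eq_vecI) auto
    then show ?case using v by (simp add: mat_sum_Nil)
  next
    case (Cons K Ks)
    have K: "K \<in> carrier_mat m n" and KK: "mat_adjoint K * K \<in> carrier_mat n n" using Cons.prems by auto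
    have Ks: "?S Ks \<in> carrier_mat n n" using Cons.prems by (intro S) auto
    have "(?S (K # Ks) *\<^sub>v v) \<bullet>c v = ((mat_adjoint K * K) *\<^sub>v v) \<bullet>c v + (?S Ks *\<^sub>v v) \<bullet>c v"
      using add_mult_distrib_mat_vec[OF KK Ks v]
        cscalar_add_left[OF mult_mat_vec_carrier[OF KK v] mult_mat_vec_carrier[OF Ks v] v]
      by (simp add: mat_sum_Cons)
    also have "((mat_adjoint K * K) *\<^sub>v v) \<bullet>c v = complex_of_real (sqnorm (K *\<^sub>v v))"
      unfolding cscalar_gram[OF K v v, symmetric] by (rule cscalar_self_sqnorm)
    finally show ?case using Cons by simp
  qed
  have "0 \<le> ((1\<^sub>m n - ?S Ks) *\<^sub>v v) \<bullet>c v" using le v by (auto simp: loewner_le_def psd_def)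
  also have "\<dots> = v \<bullet>c v - (?S Ks *\<^sub>v v) \<bullet>c v"
    using minus_mult_distrib_mat_vec[OF one_carrier_mat S[OF Ks] v]
      cscalar_minus_left[OF v mult_mat_vec_carrier[OF S[OF Ks] v] v] v by simp
  also have "\<dots> = complex_of_real (sqnorm v - (\<Sum>K\<leftarrow>Ks. sqnorm (K *\<^sub>v v)))"
    unfolding eq cscalar_self_sqnorm by simp
  finally show ?thesis by (simp add: less_eq_complex_def)
qed

text \<open>Pair \<rho> with the positive operator 1 minus the sum of K* K. For tr \<rho> = 1 the
  numbers on the left become weights of total at most one.\<close>

lemma kraus_trace_le:
  assumes \<rho>: "psd n \<rho>" and Ks: "set Ks \<subseteq> carrier_mat m n"
    and le: "loewner_le n (mat_sum n n (map (\<lambda>K. mat_adjoint K * K) Ks)) (1\<^sub>m n)"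
  shows "(\<Sum>K\<leftarrow>Ks. Re (mat_trace (\<rho> * (mat_adjoint K * K)))) \<le> Re (mat_trace \<rho>)"
proof -
  let ?S = "\<lambda>Ks. mat_sum n n (map (\<lambda>K. mat_adjoint K * K) Ks)"
  have \<rho>c: "\<rho> \<in> carrier_mat n n" using \<rho> by (rule psd_carrier)
  have S: "?S Ks \<in> carrier_mat n n" if "set Ks \<subseteq> carrier_mat m n" for Ks
    using that by (intro mat_sum_dims) (auto intro!: mult_carrier_mat[of _ n m])
  have eq: "Re (mat_trace (\<rho> * ?S Ks)) = (\<Sum>K\<leftarrow>Ks. Re (mat_trace (\<rho> * (mat_adjoint K * K))))"
    using Ks
  proof (induction Ks)
    case Nil
    then show ?case using \<rho>c by (simp add: mat_sum_Nil mat_trace_def)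
  next
    case (Cons K Ks)
    have KK: "mat_adjoint K * K \<in> carrier_mat n n" using Cons.prems by auto
    have Ks: "?S Ks \<in> carrier_mat n n" using Cons.prems by (intro S) auto
    have "\<rho> * ?S (K # Ks) = \<rho> * (mat_adjoint K * K) + \<rho> * ?S Ks"
      using mult_add_distrib_mat[OF \<rho>c KK Ks] by (simp add: mat_sum_Cons)
    then show ?case
      using Cons trace_add[OF mult_carrier_mat[OF \<rho>c KK] mult_carrier_mat[OF \<rho>c Ks]] by simp
  qed
  have "0 \<le> mat_trace (\<rho> * (1\<^sub>m n - ?S Ks))"
    using le by (intro psd_trace_mult[OF \<rho>]) (auto simp: loewner_le_def)
  also have "\<dots> = mat_trace \<rho> - mat_trace (\<rho> * ?S Ks)"
    unfolding mult_minus_distrib_mat[OF \<rho>c one_carrier_mat S[OF Ks]] right_mult_one_mat[OF \<rho>c]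
    by (rule trace_minus[OF \<rho>c mult_carrier_mat[OF \<rho>c S[OF Ks]]])
  finally show ?thesis using eq by (simp add: less_eq_complex_def)
qed

text \<open>Cauchy-Schwarz for a unit coefficient vector: subtracting from x its projection onto the
  conjugate of c leaves squared length |x|^2 - |z|^2, which is nonnegative.\<close>

lemma cmod_sum_list_square_le:
  fixes c x :: "'a \<Rightarrow> complex"
  assumes c: "(\<Sum>A\<leftarrow>As. (cmod (c A))\<^sup>2) = 1"
  shows "(cmod (\<Sum>A\<leftarrow>As. c A * x A))\<^sup>2 \<le> (\<Sum>A\<leftarrow>As. (cmod (x A))\<^sup>2)"
proof -
  define z where "z = (\<Sum>A\<leftarrow>As. c A * x A)"
  \<comment> \<open>The identity is proved for an arbitrary z, because the particular z above is a
    sum over the whole list and would not survive the induction.\<close>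
  have "(\<Sum>A\<leftarrow>As. (cmod (x A - cnj (c A) * z))\<^sup>2)
    = (\<Sum>A\<leftarrow>As. (cmod (x A))\<^sup>2) - 2 * Re (cnj z * (\<Sum>A\<leftarrow>As. c A * x A)) + (cmod z)\<^sup>2 * (\<Sum>A\<leftarrow>As. (cmod (c A))\<^sup>2)" for z
  proof (induction As)
    case (Cons A As)
    have "(cmod (x A - cnj (c A) * z))\<^sup>2 = (cmod (x A))\<^sup>2 - 2 * Re (cnj z * (c A * x A)) + (cmod z)\<^sup>2 * (cmod (c A))\<^sup>2"
      by (simp add: cmod_power2) (simp add: power2_eq_square algebra_simps)
    then show ?case using Cons by (simp add: algebra_simps)
  qed simp
  from this[of z] have "(\<Sum>A\<leftarrow>As. (cmod (x A - cnj (c A) * z))\<^sup>2) = (\<Sum>A\<leftarrow>As. (cmod (x A))\<^sup>2) - (cmod z)\<^sup>2"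
    unfolding c z_def[symmetric] cmod_power2[of z] by (simp add: power2_eq_square)
  moreover have "0 \<le> (\<Sum>A\<leftarrow>As. (cmod (x A - cnj (c A) * z))\<^sup>2)" by (intro sum_list_nonneg) auto
  ultimately show ?thesis by (simp add: z_def)
qed

lemma mat_combination_mult_vec:
  assumes "set As \<subseteq> carrier_mat m n" "v \<in> carrier_vec n" "i < m"
  shows "(mat_sum m n (map (\<lambda>A. c A \<cdot>\<^sub>m A) As) *\<^sub>v v) $ i = (\<Sum>A\<leftarrow>As. c A * (A *\<^sub>v v) $ i)"
  using assms(1)
proof (induction As)
  case Nil
  then show ?case using assms by (simp add: mat_sum_Nil)
next
  case (Cons A As)
  let ?S = "mat_sum m n (map (\<lambda>A. c A \<cdot>\<^sub>m A) As)"
  have A: "A \<in> carrier_mat m n" using Cons.prems by simp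
  have S: "?S \<in> carrier_mat m n" using Cons.prems by (intro mat_sum_dims) auto
  have "(c A \<cdot>\<^sub>m A + ?S) *\<^sub>v v = (c A \<cdot>\<^sub>m A) *\<^sub>v v + ?S *\<^sub>v v"
    using add_mult_distrib_mat_vec[OF smult_carrier_mat[OF A] S assms(2)] .
  moreover have "((c A \<cdot>\<^sub>m A) *\<^sub>v v) $ i = c A * (A *\<^sub>v v) $ i"
    using A assms by (simp add: smult_scalar_prod_distrib[of _ n])
  ultimately show ?case
    using Cons S assms by (simp add: mat_sum_Cons del: index_mult_mat_vec)
qed

lemma trace_combination:
  assumes "set As \<subseteq> carrier_mat n m" and \<rho>: "\<rho> \<in> carrier_mat n n" and Y: "Y \<in> carrier_mat m n"
  shows "mat_trace (\<rho> * (mat_sum n m (map (\<lambda>A. c A \<cdot>\<^sub>m A) As) * Y)) = (\<Sum>A\<leftarrow>As. c A * mat_trace (\<rho> * (A * Y)))"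
  using assms(1)
proof (induction As)
  case Nil
  have "0\<^sub>m n m * Y = 0\<^sub>m n n" using Y by simp
  then show ?case using \<rho> by (simp add: mat_sum_Nil mat_trace_def)
next
  case (Cons A As)
  let ?S = "mat_sum n m (map (\<lambda>A. c A \<cdot>\<^sub>m A) As)"
  have A: "A \<in> carrier_mat n m" using Cons.prems by simp
  have S: "?S \<in> carrier_mat n m" using Cons.prems by (intro mat_sum_dims) auto
  have AY: "A * Y \<in> carrier_mat n n" and SY: "?S * Y \<in> carrier_mat n n" using A S Y by auto
  have "\<rho> * ((c A \<cdot>\<^sub>m A + ?S) * Y) = c A \<cdot>\<^sub>m (\<rho> * (A * Y)) + \<rho> * (?S * Y)"
    unfolding add_mult_distrib_mat[OF smult_carrier_mat[OF A] S Y] mult_smult_assoc_mat[OF A Y]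
      mult_add_distrib_mat[OF \<rho> smult_carrier_mat[OF AY] SY] mult_smult_distrib[OF \<rho> AY] ..
  then show ?case
    using Cons trace_add[OF smult_carrier_mat[OF mult_carrier_mat[OF \<rho> AY]] mult_carrier_mat[OF \<rho> SY]]
      trace_smult[OF mult_carrier_mat[OF \<rho> AY]]
    by (simp add: mat_sum_Cons)
qed

text \<open>Cauchy-Schwarz in each coordinate of the image vector, summed over the
  coordinates.\<close>

lemma combination_contraction:
  assumes As: "set As \<subseteq> carrier_mat n m"
    and contr: "\<And>v. v \<in> carrier_vec m \<Longrightarrow> (\<Sum>A\<leftarrow>As. sqnorm (A *\<^sub>v v)) \<le> sqnorm v"
    and c: "(\<Sum>A\<leftarrow>As. (cmod (c A))\<^sup>2) = 1"
    and v: "v \<in> carrier_vec m"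
  shows "sqnorm (mat_sum n m (map (\<lambda>A. c A \<cdot>\<^sub>m A) As) *\<^sub>v v) \<le> sqnorm v"
proof -
  let ?B = "mat_sum n m (map (\<lambda>A. c A \<cdot>\<^sub>m A) As)"
  have B: "?B \<in> carrier_mat n m" using As by (intro mat_sum_dims) auto
  have "sqnorm (?B *\<^sub>v v) = (\<Sum>i<n. (cmod (\<Sum>A\<leftarrow>As. c A * (A *\<^sub>v v) $ i))\<^sup>2)"
    unfolding sqnorm_def using B mat_combination_mult_vec[OF As v] by (simp del: index_mult_mat_vec)
  also have "\<dots> \<le> (\<Sum>i<n. \<Sum>A\<leftarrow>As. (cmod ((A *\<^sub>v v) $ i))\<^sup>2)"
    by (intro sum_mono cmod_sum_list_square_le c)
  also have "\<dots> = (\<Sum>A\<leftarrow>As. sqnorm (A *\<^sub>v v))"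
    using As by (induction As) (auto simp: sqnorm_def sum.distrib simp del: index_mult_mat_vec)
  also have "\<dots> \<le> sqnorm v" by (rule contr[OF v])
  finally show ?thesis .
qed

text \<open>The adjoint of a contraction is a contraction. For w = B* u one has <B w, u> = |w|^2, so
  |u - B w|^2 = |u|^2 - 2 |w|^2 + |B w|^2; this is nonnegative and |B w| \<le> |w|, whence |w| \<le>
  |u|.\<close>

lemma contraction_adjoint_psd:
  assumes B: "B \<in> carrier_mat n m" and contr: "\<And>v. v \<in> carrier_vec m \<Longrightarrow> sqnorm (B *\<^sub>v v) \<le> sqnorm v"
  shows "psd n (1\<^sub>m n - B * mat_adjoint B)"
  unfolding psd_def
proof (intro conjI ballI)
  have BB: "B * mat_adjoint B \<in> carrier_mat n n" using B by auto
  then show "1\<^sub>m n - B * mat_adjoint B \<in> carrier_mat n n" by (rule minus_carrier_mat)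
  fix u :: "complex vec" assume u: "u \<in> carrier_vec n"
  define w where "w = mat_adjoint B *\<^sub>v u"
  have w: "w \<in> carrier_vec m" using mult_mat_vec_carrier[OF adjoint_carrier[OF B] u] by (simp add: w_def)
  have Bw: "B *\<^sub>v w \<in> carrier_vec n" using B w by (rule mult_mat_vec_carrier)
  have Bwu: "(B *\<^sub>v w) \<bullet>c u = complex_of_real (sqnorm w)"
    using cscalar_adjoint[OF B w u] by (simp add: w_def cscalar_self_sqnorm)
  have d: "u - B *\<^sub>v w \<in> carrier_vec n" using u Bw by auto
  have "complex_of_real (sqnorm (u - B *\<^sub>v w)) = u \<bullet>c u - u \<bullet>c (B *\<^sub>v w) - ((B *\<^sub>v w) \<bullet>c u - (B *\<^sub>v w) \<bullet>c (B *\<^sub>v w))"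
    unfolding cscalar_self_sqnorm[symmetric] cscalar_minus_left[OF u Bw d] cscalar_minus_right[OF u u Bw]
      cscalar_minus_right[OF Bw u Bw] by simp
  also have "u \<bullet>c (B *\<^sub>v w) = complex_of_real (sqnorm w)"
    unfolding cscalar_commute[OF Bw u] Bwu by simp
  finally have "complex_of_real (sqnorm (u - B *\<^sub>v w)) = complex_of_real (sqnorm u - 2 * sqnorm w + sqnorm (B *\<^sub>v w))"
    unfolding Bwu cscalar_self_sqnorm by simp
  then have "sqnorm (u - B *\<^sub>v w) = sqnorm u - 2 * sqnorm w + sqnorm (B *\<^sub>v w)"
    by (simp only: of_real_eq_iff)
  then have le: "sqnorm w \<le> sqnorm u"
    using contr[OF w] sqnorm_nonneg[of "u - B *\<^sub>v w"] by linarith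
  have "((1\<^sub>m n - B * mat_adjoint B) *\<^sub>v u) \<bullet>c u = u \<bullet>c u - (B *\<^sub>v w) \<bullet>c u"
    using minus_mult_distrib_mat_vec[OF one_carrier_mat BB u] assoc_mult_mat_vec[OF B adjoint_carrier[OF B] u]
      cscalar_minus_left[OF u Bw u] u by (simp add: w_def)
  also have "\<dots> = complex_of_real (sqnorm u - sqnorm w)" unfolding Bwu cscalar_self_sqnorm by simp
  finally show "0 \<le> ((1\<^sub>m n - B * mat_adjoint B) *\<^sub>v u) \<bullet>c u" using le by (simp add: less_eq_complex_def)
qed

lemma compose_contraction:
  assumes Ks: "set Ks \<subseteq> carrier_mat m n" and Js: "set Js \<subseteq> carrier_mat l m"
    and K: "\<And>v. v \<in> carrier_vec n \<Longrightarrow> (\<Sum>A\<leftarrow>Ks. sqnorm (A *\<^sub>v v)) \<le> sqnorm v"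
    and J: "\<And>v. v \<in> carrier_vec m \<Longrightarrow> (\<Sum>A\<leftarrow>Js. sqnorm (A *\<^sub>v v)) \<le> sqnorm v"
    and v: "v \<in> carrier_vec n"
  shows "(\<Sum>A\<leftarrow>concat (map (\<lambda>K. map (\<lambda>J. J * K) Js) Ks). sqnorm (A *\<^sub>v v)) \<le> sqnorm v"
proof -
  have "(\<Sum>A\<leftarrow>concat (map (\<lambda>K. map (\<lambda>J. J * K) Js) Ks). sqnorm (A *\<^sub>v v)) \<le> (\<Sum>A\<leftarrow>Ks. sqnorm (A *\<^sub>v v))"
    using Ks
  proof (induction Ks)
    case (Cons K Ks)
    have Kc: "K \<in> carrier_mat m n" using Cons.prems by simp
    have eq: "map (\<lambda>J. sqnorm (J * K *\<^sub>v v)) Js = map (\<lambda>J. sqnorm (J *\<^sub>v (K *\<^sub>v v))) Js"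
      using Js Kc v by (auto simp: assoc_mult_mat_vec[of _ l m _ n])
    have "(\<Sum>J\<leftarrow>Js. sqnorm (J * K *\<^sub>v v)) \<le> sqnorm (K *\<^sub>v v)"
      unfolding eq by (rule J[OF mult_mat_vec_carrier[OF Kc v]])
    then show ?case using Cons by (simp add: o_def)
  qed simp
  then show ?thesis using K[OF v] by linarith
qed

text \<open>Averaging: if f x < F p x at every x with f x > 0, summation would give F < F. It serves
  to choose a Kraus operator of \<C> whose share of the fidelity is at least F times its
  weight.\<close>

lemma weighted_pick:
  fixes f p :: "'a \<Rightarrow> real"
  assumes F: "(\<Sum>x\<leftarrow>xs. f x) = F" "0 < F" and p: "(\<Sum>x\<leftarrow>xs. p x) \<le> 1" and p0: "\<And>x. x \<in> set xs \<Longrightarrow> 0 \<le> p x"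
  shows "\<exists>x\<in>set xs. 0 < f x \<and> F * p x \<le> f x"
proof (rule ccontr)
  assume no: "\<not> ?thesis"
  have less: "f x < F * p x" if x: "x \<in> set xs" "0 < f x" for x
    using no x by force
  \<comment> \<open>Entries with f x at most zero satisfy the bound because F p x is nonnegative.
    Strictness is needed at one entry only, and F > 0 supplies an entry with f x > 0.\<close>
  have le: "f x \<le> F * p x" if x: "x \<in> set xs" for x
    using less[OF x] mult_nonneg_nonneg[of F "p x"] p0[OF x] F(2) by linarith
  have "\<exists>x\<in>set xs. 0 < f x"
  proof (rule ccontr)
    assume "\<not> ?thesis"
    then have "(\<Sum>x\<leftarrow>xs. f x) \<le> 0" by (intro sum_list_nonpos) force
    then show False using F by simp
  qed
  then obtain y where y: "y \<in> set xs" "f y < F * p y" using less by blast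
  have "(\<Sum>x\<leftarrow>xs. f x) < (\<Sum>x\<leftarrow>xs. F * p x)" using y le
  proof (induction xs)
    case (Cons a xs)
    have "(\<Sum>x\<leftarrow>xs. f x) \<le> (\<Sum>x\<leftarrow>xs. F * p x)" using Cons.prems by (intro sum_list_mono) auto
    moreover have "f a \<le> F * p a" using Cons.prems by simp
    moreover have "(\<Sum>x\<leftarrow>xs. f x) < (\<Sum>x\<leftarrow>xs. F * p x)" if "y \<in> set xs"
      using Cons.IH Cons.prems that by auto
    ultimately show ?case using Cons.prems by (cases "y = a") (auto simp: add_less_le_mono add_le_less_mono)
  qed simp
  also have "\<dots> = F * (\<Sum>x\<leftarrow>xs. p x)" by (rule sum_list_const_mult)
  also have "\<dots> \<le> F" using p F(2) by simp
  finally show False using F by simp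
qed

text \<open>Every vector lies in the kernel, so only v = 0 is orthogonal to it. This W serves when
  the given fidelity is zero.\<close>

lemma zero_partial_isometry: "partial_isometry n m (0\<^sub>m m n)"
  unfolding partial_isometry_def
proof (intro conjI ballI impI)
  fix v :: "complex vec" assume v: "v \<in> carrier_vec n"
    and perp: "\<forall>u\<in>carrier_vec n. 0\<^sub>m m n *\<^sub>v u = 0\<^sub>v m \<longrightarrow> v \<bullet>c u = 0"
  have z: "0\<^sub>m m n *\<^sub>v v = 0\<^sub>v m" using v by (intro eq_vecI) auto
  then have "v \<bullet>c v = 0" using perp v by simp
  then show "(0\<^sub>m m n *\<^sub>v v) \<bullet>c (0\<^sub>m m n *\<^sub>v v) = v \<bullet>c v" unfolding z by simp
qed simp

text \<open>Taking traces in the gap inequality, s is at most the trace of \<rho> \<rho>, which is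
  at most the square of tr \<rho>.\<close>

lemma spectral_gap_le_one:
  assumes \<rho>: "psd n \<rho>" and tr: "mat_trace \<rho> = 1"
    and gap: "psd n (\<rho> * \<rho> - complex_of_real s \<cdot>\<^sub>m \<rho>)"
  shows "s \<le> 1"
proof -
  have \<rho>c: "\<rho> \<in> carrier_mat n n" using \<rho> by (rule psd_carrier)
  have "0 \<le> mat_trace (\<rho> * \<rho>) - complex_of_real s"
    using psd_trace[OF gap] trace_minus[OF mult_carrier_mat[OF \<rho>c \<rho>c] smult_carrier_mat[OF \<rho>c]]
      trace_smult[OF \<rho>c] tr by simp
  moreover have "mat_trace (\<rho> * \<rho>) \<le> 1" using psd_trace_square_le[OF \<rho>] tr by simp
  ultimately show ?thesis by (simp add: less_eq_complex_def)
qed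

text \<open>The operator \<open>L\<close> is picked so that \<open>tr (\<rho> L\<^sup>* L) \<le> f / F\<close>. Then \<open>tr (\<rho> M M\<^sup>*) \<ge> 0\<close> for
  \<open>M = B - (F / sqrt f) L\<^sup>*\<close> replaces Cauchy--Schwarz in the bound \<open>F \<le> tr (\<rho> B B\<^sup>*)\<close>.\<close>

lemma kraus_single_operator:
  assumes \<rho>: "psd n \<rho>" and tr: "mat_trace \<rho> = 1"
    and As: "set As \<subseteq> carrier_mat n m"
    and contr: "\<And>v. v \<in> carrier_vec m \<Longrightarrow> (\<Sum>A\<leftarrow>As. sqnorm (A *\<^sub>v v)) \<le> sqnorm v"
    and Ls: "set Ls \<subseteq> carrier_mat m n"
    and Ls_le: "loewner_le n (mat_sum n n (map (\<lambda>L. mat_adjoint L * L) Ls)) (1\<^sub>m n)"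
    and F: "F = (\<Sum>L\<leftarrow>Ls. \<Sum>A\<leftarrow>As. (cmod (mat_trace (\<rho> * (A * L))))\<^sup>2)" "0 < F"
  obtains B where "B \<in> carrier_mat n m" "psd n (1\<^sub>m n - B * mat_adjoint B)"
    "F \<le> Re (mat_trace (\<rho> * (B * mat_adjoint B)))"
    "\<And>W. W \<in> carrier_mat m n \<Longrightarrow>
      (cmod (mat_trace (\<rho> * (B * W))))\<^sup>2 \<le> (\<Sum>A\<leftarrow>As. (cmod (mat_trace (\<rho> * (A * W))))\<^sup>2)"
proof -
  have \<rho>c: "\<rho> \<in> carrier_mat n n" and \<rho>h: "mat_adjoint \<rho> = \<rho>"
    using \<rho> by (auto dest: psd_carrier psd_hermitian)
  define f where "f L = (\<Sum>A\<leftarrow>As. (cmod (mat_trace (\<rho> * (A * L))))\<^sup>2)" for L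
  define p where "p L = Re (mat_trace (\<rho> * (mat_adjoint L * L)))" for L
  have p_real: "mat_trace (\<rho> * (mat_adjoint L * L)) = complex_of_real (p L)" and p0: "0 \<le> p L"
    if "L \<in> set Ls" for L
  proof -
    have "0 \<le> mat_trace (\<rho> * (mat_adjoint L * L))"
      using Ls that by (intro psd_trace_mult[OF \<rho>] psd_gram) auto
    then show "mat_trace (\<rho> * (mat_adjoint L * L)) = complex_of_real (p L)" "0 \<le> p L"
      by (auto simp: p_def less_eq_complex_def complex_eq_iff)
  qed
  have "(\<Sum>L\<leftarrow>Ls. p L) \<le> 1"
    unfolding p_def using kraus_trace_le[OF \<rho> Ls Ls_le] tr by simp
  moreover have "(\<Sum>L\<leftarrow>Ls. f L) = F" unfolding f_def F(1) ..
  ultimately obtain L where L: "L \<in> set Ls" and fL: "0 < f L" and pf: "F * p L \<le> f L"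
    using weighted_pick[of f Ls F p] F(2) p0 by blast
  have Lc: "L \<in> carrier_mat m n" using L Ls by auto
  have L': "mat_adjoint L \<in> carrier_mat n m" using Lc by simp
  define z where "z = sqrt (f L)"
  have z: "0 < z" "z * z = f L" using fL by (auto simp: z_def)
  \<comment> \<open>Conjugated traces scaled to a unit vector: this choice makes tr (\<rho> B L)
    attain the Cauchy-Schwarz value z = sqrt (f L).\<close>
  define c where "c A = cnj (mat_trace (\<rho> * (A * L))) / complex_of_real z" for A
  have "(\<Sum>A\<leftarrow>As. (cmod (c A))\<^sup>2) = (\<Sum>A\<leftarrow>As. inverse (z * z) * (cmod (mat_trace (\<rho> * (A * L))))\<^sup>2)"
    using z(1) by (simp add: c_def norm_divide power2_eq_square field_simps)
  also have "\<dots> = inverse (z * z) * f L" unfolding f_def by (rule sum_list_const_mult)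
  also have "\<dots> = 1" using z fL by simp
  finally have c: "(\<Sum>A\<leftarrow>As. (cmod (c A))\<^sup>2) = 1" .
  define B where "B = mat_sum n m (map (\<lambda>A. c A \<cdot>\<^sub>m A) As)"
  have B: "B \<in> carrier_mat n m" unfolding B_def using As by (intro mat_sum_dims) auto
  have B': "mat_adjoint B \<in> carrier_mat m n" using B by simp
  have B_contr: "psd n (1\<^sub>m n - B * mat_adjoint B)"
  proof (rule contraction_adjoint_psd[OF B])
    show "sqnorm (B *\<^sub>v v) \<le> sqnorm v" if "v \<in> carrier_vec m" for v
      unfolding B_def using As contr c that by (rule combination_contraction)
  qed
  have B_tr: "mat_trace (\<rho> * (B * Y)) = (\<Sum>A\<leftarrow>As. c A * mat_trace (\<rho> * (A * Y)))" if "Y \<in> carrier_mat m n" for Y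
    unfolding B_def by (rule trace_combination[OF As \<rho>c that])
  have BL: "mat_trace (\<rho> * (B * L)) = complex_of_real z"
  proof -
    have "mat_trace (\<rho> * (B * L)) = (\<Sum>A\<leftarrow>As. complex_of_real ((cmod (mat_trace (\<rho> * (A * L))))\<^sup>2 / z))"
      unfolding B_tr[OF Lc] c_def
      by (intro arg_cong[where f = sum_list] map_cong refl) (simp only: of_real_divide complex_norm_square, simp)
    also have "\<dots> = complex_of_real (f L / z)"
      unfolding f_def by (induction As) (simp_all add: add_divide_distrib)
    also have "f L / z = z" using z by (simp add: field_simps)
    finally show ?thesis .
  qed
  have LB: "mat_trace (\<rho> * (mat_adjoint L * mat_adjoint B)) = complex_of_real z"
  proof -
    have BLc: "B * L \<in> carrier_mat n n" using B Lc by (rule mult_carrier_mat)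
    have "\<rho> * (mat_adjoint L * mat_adjoint B) = mat_adjoint (B * L * \<rho>)"
      unfolding adjoint_mult[OF BLc \<rho>c] adjoint_mult[OF B Lc] \<rho>h ..
    then show ?thesis
      using trace_adjoint[OF mult_carrier_mat[OF BLc \<rho>c]] trace_comm[OF BLc \<rho>c] BL by simp
  qed
  have "0 \<le> mat_trace (\<rho> * (B * mat_adjoint B))"
    using psd_trace_mult[OF \<rho> psd_gram[OF B']] by simp
  then obtain b where b: "mat_trace (\<rho> * (B * mat_adjoint B)) = complex_of_real b"
    by (metis complex_nonneg_real)
  have "F \<le> b"
  proof -
    \<comment> \<open>In the trace of \<rho> M M* this k makes the two cross terms add up to -2 F,
      and F p \<le> f bounds the quadratic term by F. What remains is b \<ge> 2 F - F.\<close>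
    define k where "k = F / z"
    define M where "M = B - complex_of_real k \<cdot>\<^sub>m mat_adjoint L"
    have kL: "complex_of_real k \<cdot>\<^sub>m mat_adjoint L \<in> carrier_mat n m" using L' by simp
    have kL': "complex_of_real k \<cdot>\<^sub>m L \<in> carrier_mat m n" using Lc by simp
    have M: "M \<in> carrier_mat n m" unfolding M_def using kL by (rule minus_carrier_mat)
    have M': "mat_adjoint M = mat_adjoint B - complex_of_real k \<cdot>\<^sub>m L"
      unfolding M_def adjoint_minus[OF B kL] adjoint_smult by simp
    have BB: "B * mat_adjoint B \<in> carrier_mat n n" and BL': "B * L \<in> carrier_mat n n"
      and LB': "mat_adjoint L * mat_adjoint B \<in> carrier_mat n n" and LL: "mat_adjoint L * L \<in> carrier_mat n n"
      using mult_carrier_mat[OF B B'] mult_carrier_mat[OF B Lc] mult_carrier_mat[OF L' B'] mult_carrier_mat[OF L' Lc] by auto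
    have MM: "M * mat_adjoint M = (B * mat_adjoint B - complex_of_real k \<cdot>\<^sub>m (B * L))
        - complex_of_real k \<cdot>\<^sub>m (mat_adjoint L * mat_adjoint B - complex_of_real k \<cdot>\<^sub>m (mat_adjoint L * L))"
    proof -
      have "M * mat_adjoint M = B * mat_adjoint M - (complex_of_real k \<cdot>\<^sub>m mat_adjoint L) * mat_adjoint M"
        using minus_mult_distrib_mat[OF B kL adjoint_carrier[OF M]] unfolding M_def .
      also have "B * mat_adjoint M = B * mat_adjoint B - complex_of_real k \<cdot>\<^sub>m (B * L)"
        unfolding M' mult_minus_distrib_mat[OF B B' kL'] mult_smult_distrib[OF B Lc] ..
      also have "(complex_of_real k \<cdot>\<^sub>m mat_adjoint L) * mat_adjoint M
          = complex_of_real k \<cdot>\<^sub>m (mat_adjoint L * mat_adjoint B - complex_of_real k \<cdot>\<^sub>m (mat_adjoint L * L))"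
        unfolding mult_smult_assoc_mat[OF L' adjoint_carrier[OF M]] unfolding M' mult_minus_distrib_mat[OF L' B' kL']
          mult_smult_distrib[OF L' Lc] ..
      finally show ?thesis .
    qed
    have tr_minus: "mat_trace (\<rho> * (X - Y)) = mat_trace (\<rho> * X) - mat_trace (\<rho> * Y)"
      if "X \<in> carrier_mat n n" "Y \<in> carrier_mat n n" for X Y
      using that \<rho>c by (simp add: mult_minus_distrib_mat[of _ n n _ n] trace_minus[of _ n])
    have tr_smult: "mat_trace (\<rho> * (a \<cdot>\<^sub>m X)) = a * mat_trace (\<rho> * X)" if "X \<in> carrier_mat n n" for a X
      using that \<rho>c by (simp add: mult_smult_distrib[of _ n n _ n] trace_smult[of _ n])
    have "0 \<le> mat_trace (\<rho> * (M * mat_adjoint M))"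
      using psd_trace_mult[OF \<rho> psd_gram[OF adjoint_carrier[OF M]]] by simp
    also have "mat_trace (\<rho> * (M * mat_adjoint M)) = complex_of_real (b - k * z - k * (z - k * p L))"
      unfolding MM using BB BL' LB' LL
      by (simp add: tr_minus tr_smult minus_carrier_mat b BL LB p_real[OF L])
    finally have "0 \<le> b - 2 * (k * z) + k * k * p L"
      by (simp add: less_eq_complex_def algebra_simps)
    moreover have "k * z = F" using z by (simp add: k_def)
    moreover have "k * k * p L \<le> F"
    proof -
      have "k * k * p L = F * (F * p L) / (z * z)" by (simp add: k_def)
      also have "\<dots> \<le> F * f L / (z * z)" using pf F(2) z(1) by (intro divide_right_mono mult_left_mono) auto
      also have "\<dots> = F" using z(2) fL by simp
      finally show ?thesis .
    qed
    ultimately show ?thesis by linarith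
  qed
  moreover have "(cmod (mat_trace (\<rho> * (B * W))))\<^sup>2 \<le> (\<Sum>A\<leftarrow>As. (cmod (mat_trace (\<rho> * (A * W))))\<^sup>2)"
    if "W \<in> carrier_mat m n" for W
    unfolding B_tr[OF that] by (rule cmod_sum_list_square_le[OF c])
  ultimately show thesis using that[OF B B_contr] b by simp
qed

section \<open>Assembly: Kraus families, the choice of B, and the partial isometry\<close>

theorem theorem1:
  fixes dL dC :: nat and \<rho> :: "complex mat" and s \<epsilon> :: real
    and \<C> \<N> \<D> \<A> :: "complex mat \<Rightarrow> complex mat"
  assumes "1 < dL" and "dL \<le> dC"
    and "psd dL \<rho>" and "mat_trace \<rho> = 1"
    and "smallest_positive_eigenvalue \<rho> s"
    and "cptni dL dC \<C>" and "cptni dC dC \<N>" and "cptni dC dL \<D>"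
    and "\<A> = \<D> \<circ> \<N>"
    and "\<epsilon> = 1 - entanglement_fidelity dL \<rho> (\<A> \<circ> \<C>)"
  shows "\<exists>W. partial_isometry dL dC W \<and>
    (let \<C>\<^sub>1 = (\<lambda>\<omega>. W * \<omega> * mat_adjoint W);
         \<epsilon>\<^sub>1 = 1 - entanglement_fidelity dL \<rho> (\<A> \<circ> \<C>\<^sub>1)
     in \<epsilon>\<^sub>1 - \<epsilon> \<le> (if \<epsilon> \<le> s then (1 / s - 1) * (ell s \<epsilon>)\<^sup>2
                     else (1 - \<epsilon>) * min \<epsilon> (1 - s)))"
proof -
  note \<rho> = \<open>psd dL \<rho>\<close> and tr = \<open>mat_trace \<rho> = 1\<close>
  have \<rho>c: "\<rho> \<in> carrier_mat dL dL" using \<rho> by (rule psd_carrier)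
  have s: "0 < s" using assms(5) by (simp add: smallest_positive_eigenvalue_def)
  have gap: "psd dL (\<rho> * \<rho> - complex_of_real s \<cdot>\<^sub>m \<rho>)" using \<rho> assms(5) by (rule psd_spectral_gap)
  have s1: "s \<le> 1" using \<rho> tr gap by (rule spectral_gap_le_one)
  obtain Ls where Ls: "kraus_operators dL dC \<C> Ls"
    and Ls_le: "loewner_le dL (mat_sum dL dL (map (\<lambda>K. mat_adjoint K * K) Ls)) (1\<^sub>m dL)"
    using assms(6) by (auto simp: cptni_def)
  obtain Ns where Ns: "kraus_operators dC dC \<N> Ns"
    and Ns_le: "loewner_le dC (mat_sum dC dC (map (\<lambda>K. mat_adjoint K * K) Ns)) (1\<^sub>m dC)"
    and Ns_lin: "linear_map dC dC \<N>"
    using assms(7) by (auto simp: cptni_def completely_positive_def)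
  obtain Ds where Ds: "kraus_operators dC dL \<D> Ds"
    and Ds_le: "loewner_le dC (mat_sum dC dC (map (\<lambda>K. mat_adjoint K * K) Ds)) (1\<^sub>m dC)"
    and Ds_lin: "linear_map dC dL \<D>"
    using assms(8) by (auto simp: cptni_def completely_positive_def)
  have Ls_c: "set Ls \<subseteq> carrier_mat dC dL" and Ns_c: "set Ns \<subseteq> carrier_mat dC dC"
    and Ds_c: "set Ds \<subseteq> carrier_mat dL dC"
    using Ls Ns Ds by (auto simp: kraus_operators_def)
  define As where "As = concat (map (\<lambda>K. map (\<lambda>J. J * K) Ds) Ns)"
  have As: "kraus_operators dC dL \<A> As"
    unfolding As_def assms(9) by (rule kraus_compose[OF Ns Ds Ds_lin])
  have As_lin: "linear_map dC dL \<A>"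
    unfolding assms(9) by (rule linear_map_compose[OF Ns_lin Ds_lin])
  have As_c: "set As \<subseteq> carrier_mat dL dC" using As by (simp add: kraus_operators_def)
  have contr: "(\<Sum>A\<leftarrow>As. sqnorm (A *\<^sub>v v)) \<le> sqnorm v" if "v \<in> carrier_vec dC" for v
    unfolding As_def
    using Ns_c Ds_c kraus_contraction[OF Ns_c Ns_le] kraus_contraction[OF Ds_c Ds_le] that
    by (rule compose_contraction)
  define F where "F = entanglement_fidelity dL \<rho> (\<A> \<circ> \<C>)"
  have F: "F = (\<Sum>L\<leftarrow>Ls. \<Sum>A\<leftarrow>As. (cmod (mat_trace (\<rho> * (A * L))))\<^sup>2)"
    unfolding F_def by (rule fidelity_compose[OF \<rho>c Ls As As_lin])
  have \<epsilon>: "\<epsilon> = 1 - F" using assms(10) by (simp add: F_def)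
  have F0: "0 \<le> F" unfolding F by (intro sum_list_nonneg) (auto intro!: sum_list_nonneg)
  have fid: "entanglement_fidelity dL \<rho> (\<A> \<circ> (\<lambda>\<omega>. W * \<omega> * mat_adjoint W))
      = (\<Sum>A\<leftarrow>As. (cmod (mat_trace (\<rho> * (A * W))))\<^sup>2)" if "W \<in> carrier_mat dC dL" for W
    using fidelity_compose[OF \<rho>c kraus_conjugation[OF that] As As_lin] by simp
  show ?thesis
  proof (cases "F = 0")
    case True
    \<comment> \<open>Here \<epsilon> = 1 and the left side is at most zero for any W. The right
      side vanishes in both cases: \<epsilon> \<le> s forces s = 1, and otherwise the factor 1 -
      \<epsilon> is zero.\<close>
    let ?W = "0\<^sub>m dC dL :: complex mat"
    have "0 \<le> entanglement_fidelity dL \<rho> (\<A> \<circ> (\<lambda>\<omega>. ?W * \<omega> * mat_adjoint ?W))"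
      unfolding fid[OF zero_carrier_mat] by (intro sum_list_nonneg) auto
    moreover have "\<epsilon> \<le> s \<Longrightarrow> s = 1" using True s1 by (simp add: \<epsilon>)
    ultimately have "1 - entanglement_fidelity dL \<rho> (\<A> \<circ> (\<lambda>\<omega>. ?W * \<omega> * mat_adjoint ?W)) - \<epsilon>
        \<le> (if \<epsilon> \<le> s then (1 / s - 1) * (ell s \<epsilon>)\<^sup>2 else (1 - \<epsilon>) * min \<epsilon> (1 - s))"
      using True by (auto simp: \<epsilon>)
    then show ?thesis unfolding Let_def using zero_partial_isometry by blast
  next
    case False
    then have "0 < F" using F0 by simp
    from kraus_single_operator[OF \<rho> tr As_c contr Ls_c Ls_le F this]
    obtain B where B: "B \<in> carrier_mat dL dC" "psd dL (1\<^sub>m dL - B * mat_adjoint B)"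
      and FB: "F \<le> Re (mat_trace (\<rho> * (B * mat_adjoint B)))"
      and BW: "\<And>W. W \<in> carrier_mat dC dL \<Longrightarrow>
        (cmod (mat_trace (\<rho> * (B * W))))\<^sup>2 \<le> (\<Sum>A\<leftarrow>As. (cmod (mat_trace (\<rho> * (A * W))))\<^sup>2)"
      by blast
    obtain W r b where W: "partial_isometry dL dC W"
      and r: "mat_trace (\<rho> * (B * W)) = complex_of_real r"
      and b: "mat_trace (\<rho> * (B * mat_adjoint B)) = complex_of_real b"
      and rb: "b \<le> r" "r \<le> 1" "s * b \<le> r\<^sup>2" "s * (1 - 2 * r + b) \<le> (1 - r)\<^sup>2"
      using polar_fidelity_bounds[OF \<rho> tr gap B] by metis
    have Wc: "W \<in> carrier_mat dC dL" using W by (simp add: partial_isometry_def)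
    \<comment> \<open>B is a unit combination of the Kraus operators of \<A>, so the fidelity with W
      dominates the single term |tr (\<rho> B W)|^2 = r^2.\<close>
    have "r\<^sup>2 \<le> entanglement_fidelity dL \<rho> (\<A> \<circ> (\<lambda>\<omega>. W * \<omega> * mat_adjoint W))"
      unfolding fid[OF Wc] using BW[OF Wc] by (simp add: r)
    moreover have "F \<le> b" using FB by (simp add: b)
    ultimately show ?thesis
      unfolding Let_def using fidelity_real_bound[OF s s1 F0 _ rb \<epsilon>] W
      by (intro exI[of _ W]) auto
  qed
qed

end
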